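(* Let $\mathfrak M$ denote the set of closed probability measures on $TM\times\{1,\dots,m\}$. Then $\mathfrak M$ is nonempty and $$-c(\mathbb H)=\min_{\mu\in\mathfrak M}\int_{TM\times\{1,\dots,m\}}L_i(x,v)\,d\mu(x,v,i),$$ the minimum being attained.
   Context: Setting: $M=\mathbb T^N$, $TM=T^*M=M\times\mathbb R^N$. $H_1,\dots,H_m:T^*M\to\mathbb R$ continuous, convex in $p$, with superlinear $\alpha,\beta:[0,\infty)\to\mathbb R$ such that $\alpha(|p|)\le H_i(x,p)\le\beta(|p|)$. $B=(b_{ij})$ real $m\times m$, $b_{ij}\le0$ for $j\neq i$, zero row sums, irreducible (for every nonempty proper $\mathcal I\subsetneq\{1,\dots,m\}$ there are $i\in\mathcal I$, $j\notin\mathcal I$ with $b_{ij}\ne0$). $c(\mathbb H)$ is the unique $c\in\mathbb R$ for which the system $\sum_jb_{ij}u_j+H_i(x,Du_i)=c$ ($i=1,\dots,m$) admits a continuous viscosity solution $\mathbf u:M\to\mathbb R^m$. $L_i(x,v)=\sup_p\{\langle p,v\rangle-H_i(x,p)\}$. A Borel probability measure $\mu$ on $TM\times\{1,\dots,m\}$ is closed if (i) $\int|v|\,d\mu(x,v,i)<\infty$ and (ii) $\int\big((B\boldsymbol\phi(x))_i+\langle D\phi_i(x),v\rangle\big)\,d\mu(x,v,i)=0$ for every $\boldsymbol\phi=(\phi_1,\dots,\phi_m)\in(C^1(M))^m$. *)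

theory Defs
  imports "HOL-Analysis.Analysis" "HOL-Probability.Probability"
begin

text \<open>The torus M = T^N is modelled by Z^N-periodic objects on real^'n; points of M are
  represented by points of the fundamental domain [0,1)^N.  The index set {1,...,m} is a
  finite type 'm.\<close>

definition int_shift :: "int^'n \<Rightarrow> real^'n" where
  "int_shift z = (\<chi> k. real_of_int (z $ k))"

definition periodic_fun :: "(real^'n \<Rightarrow> 'b) \<Rightarrow> bool" where
  "periodic_fun f \<longleftrightarrow> (\<forall>x z. f (x + int_shift z) = f x)"

definition fund_domain :: "(real^'n) set" where
  "fund_domain = {x. \<forall>k. 0 \<le> x $ k \<and> x $ k < 1}"

definition C1_grad :: "(real^'n \<Rightarrow> real) \<Rightarrow> (real^'n \<Rightarrow> real^'n) \<Rightarrow> bool" where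
  "C1_grad phi Dphi \<longleftrightarrow> continuous_on UNIV Dphi \<and>
     (\<forall>x. (phi has_derivative (\<lambda>h. Dphi x \<bullet> h)) (at x))"

definition superlinear :: "(real \<Rightarrow> real) \<Rightarrow> bool" where
  "superlinear f \<longleftrightarrow> filterlim (\<lambda>r. f r / r) at_top at_top"

definition coupling_matrix :: "('m::finite \<Rightarrow> 'm \<Rightarrow> real) \<Rightarrow> bool" where
  "coupling_matrix B \<longleftrightarrow>
     (\<forall>i j. j \<noteq> i \<longrightarrow> B i j \<le> 0) \<and>
     (\<forall>i. (\<Sum>j\<in>UNIV. B i j) = 0) \<and>
     (\<forall>I. I \<noteq> {} \<and> I \<noteq> UNIV \<longrightarrow> (\<exists>i\<in>I. \<exists>j. j \<notin> I \<and> B i j \<noteq> 0))"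

definition visc_subsol ::
  "('m::finite \<Rightarrow> real^'n \<Rightarrow> real^'n \<Rightarrow> real) \<Rightarrow> ('m \<Rightarrow> 'm \<Rightarrow> real) \<Rightarrow> real
     \<Rightarrow> ('m \<Rightarrow> real^'n \<Rightarrow> real) \<Rightarrow> bool" where
  "visc_subsol H B c u \<longleftrightarrow>
     (\<forall>i x phi Dphi. C1_grad phi Dphi \<and>
        (\<exists>e>0. \<forall>y. dist y x < e \<longrightarrow> u i y - phi y \<le> u i x - phi x) \<longrightarrow>
        (\<Sum>j\<in>UNIV. B i j * u j x) + H i x (Dphi x) \<le> c)"

definition visc_supersol ::
  "('m::finite \<Rightarrow> real^'n \<Rightarrow> real^'n \<Rightarrow> real) \<Rightarrow> ('m \<Rightarrow> 'm \<Rightarrow> real) \<Rightarrow> real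
     \<Rightarrow> ('m \<Rightarrow> real^'n \<Rightarrow> real) \<Rightarrow> bool" where
  "visc_supersol H B c u \<longleftrightarrow>
     (\<forall>i x phi Dphi. C1_grad phi Dphi \<and>
        (\<exists>e>0. \<forall>y. dist y x < e \<longrightarrow> u i y - phi y \<ge> u i x - phi x) \<longrightarrow>
        (\<Sum>j\<in>UNIV. B i j * u j x) + H i x (Dphi x) \<ge> c)"

definition visc_sol ::
  "('m::finite \<Rightarrow> real^'n \<Rightarrow> real^'n \<Rightarrow> real) \<Rightarrow> ('m \<Rightarrow> 'm \<Rightarrow> real) \<Rightarrow> real
     \<Rightarrow> ('m \<Rightarrow> real^'n \<Rightarrow> real) \<Rightarrow> bool" where
  "visc_sol H B c u \<longleftrightarrow>
     (\<forall>i. continuous_on UNIV (u i) \<and> periodic_fun (u i)) \<and>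
     visc_subsol H B c u \<and> visc_supersol H B c u"

definition lagrangian ::
  "('m \<Rightarrow> real^'n \<Rightarrow> real^'n \<Rightarrow> real) \<Rightarrow> 'm \<Rightarrow> real^'n \<Rightarrow> real^'n \<Rightarrow> real" where
  "lagrangian H i x v = (SUP p. p \<bullet> v - H i x p)"

definition closed_measure ::
  "('m::finite \<Rightarrow> 'm \<Rightarrow> real) \<Rightarrow> ((((real^'n) \<times> (real^'n)) \<times> 'm) measure) \<Rightarrow> bool" where
  "closed_measure B \<mu> \<longleftrightarrow>
     prob_space \<mu> \<and>
     sets \<mu> = sets (borel \<Otimes>\<^sub>M count_space UNIV) \<and>
     (AE z in \<mu>. fst (fst z) \<in> fund_domain) \<and>
     integrable \<mu> (\<lambda>z. norm (snd (fst z))) \<and>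
     (\<forall>phi Dphi. (\<forall>i. periodic_fun (phi i) \<and> C1_grad (phi i) (Dphi i)) \<longrightarrow>
        (\<integral>z. (\<Sum>j\<in>UNIV. B (snd z) j * phi j (fst (fst z)))
               + Dphi (snd z) (fst (fst z)) \<bullet> snd (fst z) \<partial>\<mu>) = 0)"

end

theory Submission
  imports Defs
begin

text \<open>Lower bound: regularizing the critical solution by a sup-convolution followed by an inf-convolution
  (Lasry--Lions) produces C^1 almost-subsolutions, and these are integrated against a closed measure.

  Existence: at a minimum of the difference between the critical solution and a test function phi, the
  supersolution property yields a point (x, v, i), with v in a ball independent of phi, at which
  L_i(x, v) + c <= (B phi(x))_i + D phi_i(x) . v.  A minimax argument in the form of an online learning
  scheme turns these pointwise answers into empirical measures that are asymptotically closed and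
  have action at most -c, and a weak limit of them is a minimizer.  Since the support is bounded, weak
  compactness reduces to Helly's theorem on the line by means of a space-filling curve.\<close>

section \<open>A space-filling curve\<close>

text \<open>The two halves are weak and strong duality between closed measures and subsolutions. In
  the first, \<open>u\<close> is given as merely continuous, so it has no gradient to integrate; a
  sup-convolution alone is semiconvex and may keep convex corners, which the inf-convolution with a
  steeper parabola rounds off. In the second, the obstacle is that the answering point depends on
  the test function, whereas one measure must serve all of them. Averages along a long play supply
  the missing convexification and need only answers to finite combinations of a countable family;
  uniform density then extends closedness to every test function. The velocity ball comes from
  coercivity: \<open>u\<close> turns out to be Lipschitz with some constant \<open>K\<close>, a test
  function touching it from below has gradient of norm at most \<open>K\<close> there, and the
  velocity is a subgradient of the convex function \<open>H i x\<close> at that momentum. The exact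
  value \<open>- c\<close> is obtained only at the end, when the lower bound is applied to the
  constructed measure.\<close>

lemma binary_digits_exist:
  fixes x :: real
  assumes "0 \<le> x" "x < 1"
  obtains d :: "nat \<Rightarrow> real" where "\<And>j. d j \<in> {0, 1}" "(\<lambda>j. d j / 2 ^ Suc j) sums x"
proof -
  define d where "d j = real_of_int (\<lfloor>2 ^ Suc j * x\<rfloor> - 2 * \<lfloor>2 ^ j * x\<rfloor>)" for j
  have "d j \<in> {0, 1}" for j
  proof -
    have "\<lfloor>2 ^ Suc j * x\<rfloor> - 2 * \<lfloor>2 ^ j * x\<rfloor> \<in> {0, 1}"
    proof -
      have "2 * \<lfloor>2 ^ j * x\<rfloor> \<le> \<lfloor>2 ^ Suc j * x\<rfloor>" "\<lfloor>2 ^ Suc j * x\<rfloor> < 2 * \<lfloor>2 ^ j * x\<rfloor> + 2"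
        by (simp_all add: le_floor_iff floor_less_iff) linarith+
      then show ?thesis by auto
    qed
    then show ?thesis by (auto simp: d_def)
  qed
  moreover have partial: "(\<Sum>j<n. d j / 2 ^ Suc j) = \<lfloor>2 ^ n * x\<rfloor> / 2 ^ n" for n
  proof (induction n)
    case 0
    have "\<lfloor>x\<rfloor> = 0" using assms by linarith
    then show ?case by simp
  next
    case (Suc n)
    then show ?case by (simp add: d_def field_simps)
  qed
  have lim: "(\<lambda>n. x - (1/2) ^ n) \<longlonglongrightarrow> x"
    using tendsto_diff[OF tendsto_const LIMSEQ_realpow_zero[of "1/2 :: real"], of x] by simp
  have lower: "x - (1/2) ^ n \<le> \<lfloor>2 ^ n * x\<rfloor> / 2 ^ n" for n
  proof -
    have "2 ^ n * x - 1 \<le> \<lfloor>2 ^ n * x\<rfloor>" by linarith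
    then show ?thesis
      by (subst le_divide_eq) (simp add: power_divide algebra_simps)
  qed
  have upper: "\<lfloor>2 ^ n * x\<rfloor> / 2 ^ n \<le> x" for n
    by (simp add: divide_le_eq mult.commute)
  have "(\<lambda>n. \<lfloor>2 ^ n * x\<rfloor> / 2 ^ n) \<longlonglongrightarrow> x"
    by (rule tendsto_sandwich[OF always_eventually always_eventually lim tendsto_const])
       (use lower upper in auto)
  then have "(\<lambda>j. d j / 2 ^ Suc j) sums x"
    unfolding sums_def partial .
  ultimately show thesis using that by blast
qed

text \<open>A clipped cosine takes the place of the usual piecewise linear wave. Since cos (pi t)
  passes 1/2 at t = 1/3 and -1/2 at t = 2/3, the wave is 0 on [0, 1/3] and 1 on [2/3, 1]: it reads
  off the first Cantor digit.\<close>

definition schoenberg_wave :: "real \<Rightarrow> real" where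
  "schoenberg_wave t = max 0 (min 1 (1/2 - cos (pi * t)))"

text \<open>The k-th coordinate of Schoenberg's curve. \<open>prod_encode\<close> gives each
  coordinate its own infinite set of ternary digits of t, so one definition serves every
  dimension.\<close>

definition schoenberg :: "nat \<Rightarrow> real \<Rightarrow> real" where
  "schoenberg k t = (\<Sum>j. schoenberg_wave (3 ^ prod_encode (k, j) * t) / 2 ^ Suc j)"

lemma schoenberg_wave_bounds: "0 \<le> schoenberg_wave t" "schoenberg_wave t \<le> 1"
  by (auto simp: schoenberg_wave_def)

lemma schoenberg_wave_shift: "schoenberg_wave (2 * real n + t) = schoenberg_wave t"
proof -
  have "pi * (2 * real n + t) = pi * t + real (2 * n) * pi" by (simp add: algebra_simps)
  also have "cos \<dots> = cos (pi * t)" by (subst cos_add) (simp del: of_nat_mult)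
  finally show ?thesis by (simp add: schoenberg_wave_def)
qed

lemma schoenberg_wave_eq_0: "0 \<le> t \<Longrightarrow> t \<le> 1/3 \<Longrightarrow> schoenberg_wave t = 0"
proof -
  assume t: "0 \<le> t" "t \<le> 1/3"
  have "pi * t \<le> pi * (1/3)" using t by (intro mult_left_mono) auto
  then have "cos (pi/3) \<le> cos (pi * t)"
    using t by (intro cos_monotone_0_pi_le) auto
  then show ?thesis by (simp add: schoenberg_wave_def cos_60)
qed

lemma schoenberg_wave_eq_1: "2/3 \<le> t \<Longrightarrow> t \<le> 1 \<Longrightarrow> schoenberg_wave t = 1"
proof -
  assume t: "2/3 \<le> t" "t \<le> 1"
  have "pi * (2/3) \<le> pi * t" "pi * t \<le> pi * 1" using t by (intro mult_left_mono; simp)+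
  then have "cos (pi * t) \<le> cos (2 * pi / 3)"
    using t by (intro cos_monotone_0_pi_le) auto
  then show ?thesis by (simp add: schoenberg_wave_def cos_120)
qed

lemma continuous_on_schoenberg: "continuous_on UNIV (schoenberg k)"
proof -
  have "uniform_limit UNIV
      (\<lambda>n t. \<Sum>j<n. schoenberg_wave (3 ^ prod_encode (k, j) * t) / 2 ^ Suc j)
      (\<lambda>t. \<Sum>j. schoenberg_wave (3 ^ prod_encode (k, j) * t) / 2 ^ Suc j) sequentially"
  proof (rule Weierstrass_m_test)
    show "norm (schoenberg_wave (3 ^ prod_encode (k, j) * t) / 2 ^ Suc j) \<le> (1/2) ^ Suc j" for j t
      using schoenberg_wave_bounds[of "3 ^ prod_encode (k, j) * t"]
      by (simp add: power_divide divide_le_cancel)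
    show "summable (\<lambda>j. (1/2 :: real) ^ Suc j)" by simp
  qed
  then show ?thesis
    unfolding schoenberg_def
    by (rule uniform_limit_theorem[rotated])
       (auto intro!: always_eventually continuous_intros simp: schoenberg_wave_def)
qed

text \<open>The Cantor expansion with digits \<^term>\<open>2 * a j\<close>: multiplying by \<^term>\<open>3 ^ m\<close> shifts the
  expansion and changes the value by an even integer, which the wave ignores.\<close>
lemma schoenberg_wave_digits:
  fixes a :: "nat \<Rightarrow> real"
  assumes a: "\<And>j. a j \<in> {0, 1}"
  obtains t where "\<And>m. schoenberg_wave (3 ^ m * t) = a m" "0 \<le> t" "t \<le> 1"
proof -
  define s where "s m = (\<Sum>j. 2 * a (j + m) / 3 ^ Suc j)" for m
  have a01: "0 \<le> a j" "a j \<le> 1" for j using a[of j] by auto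
  have geo: "(\<lambda>j. 2 / 3 * (1/3 :: real) ^ j) sums 1"
    using sums_mult[OF geometric_sums[of "1/3 :: real"], of "2/3"] by simp
  have le: "2 * a (j + m) / 3 ^ Suc j \<le> 2 / 3 * (1/3 :: real) ^ j" for j m
    using a01[of "j + m"] by (simp add: power_divide divide_le_cancel)
  have nn: "0 \<le> 2 * a (j + m) / 3 ^ Suc j" for j m
    using a01 by simp
  have summ: "summable (\<lambda>j. 2 * a (j + m) / 3 ^ Suc j)" for m
  proof (rule summable_comparison_test'[of _ 0])
    show "summable (\<lambda>j. 2 / 3 * (1/3 :: real) ^ j)" by (rule sums_summable[OF geo])
    show "norm (2 * a (j + m) / 3 ^ Suc j) \<le> 2 / 3 * (1/3) ^ j" for j
      using le[of j m] nn[of j m] by (simp only: real_norm_def abs_of_nonneg)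
  qed
  have s01: "0 \<le> s m" "s m \<le> 1" for m
    using suminf_le[OF le summ sums_summable[OF geo], of m] suminf_nonneg[OF summ nn, of m]
    by (simp_all only: s_def sums_unique[OF geo, symmetric])
  have rec: "s m = 2 * a m / 3 + s (Suc m) / 3" for m
  proof -
    have "s m = (\<Sum>j. 2 * a (Suc j + m) / 3 ^ Suc (Suc j)) + 2 * a m / 3"
      unfolding s_def using suminf_split_initial_segment[OF summ[of m], of 1] by simp
    also have "(\<Sum>j. 2 * a (Suc j + m) / 3 ^ Suc (Suc j)) = (\<Sum>j. (1/3) * (2 * a (j + Suc m) / 3 ^ Suc j))"
      by (intro suminf_cong) simp
    also have "\<dots> = (1/3) * s (Suc m)"
      unfolding s_def by (rule suminf_mult[OF summ])
    finally show ?thesis by simp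
  qed
  have shift: "\<exists>N::nat. 3 ^ m * s 0 = 2 * real N + s m" for m
  proof (induction m)
    case 0
    show ?case by (rule exI[of _ 0]) simp
  next
    case (Suc m)
    then obtain N where "3 ^ m * s 0 = 2 * real N + s m" by blast
    then have "3 ^ Suc m * s 0 = 6 * real N + 2 * a m + s (Suc m)"
      using rec[of m] by simp
    moreover have "\<exists>A::nat. a m = real A"
      using a[of m] by (auto intro: exI[of _ 0] exI[of _ 1])
    then obtain A :: nat where "a m = real A" ..
    ultimately have "3 ^ Suc m * s 0 = 2 * real (3 * N + A) + s (Suc m)"
      by simp
    then show ?case by blast
  qed
  have "schoenberg_wave (3 ^ m * s 0) = a m" for m
  proof -
    from shift[of m] obtain N :: nat where N: "3 ^ m * s 0 = 2 * real N + s m" ..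
    \<comment> \<open>By \<open>rec\<close> and 0 <= s (Suc m) <= 1, \<open>s m\<close> lies in
      [0, 1/3] if \<open>a m\<close> is 0 and in [2/3, 1] if it is 1, exactly where the wave is
      constant.\<close>
    have "schoenberg_wave (s m) = a m"
      using a[of m] rec[of m] s01[of "Suc m"]
      by (auto intro!: schoenberg_wave_eq_0 schoenberg_wave_eq_1)
    then show ?thesis by (simp only: N schoenberg_wave_shift)
  qed
  then show thesis using that s01[of 0] by blast
qed

text \<open>The binary digits of all coordinates are interleaved into one 0-1 sequence, and the
  Cantor number carrying it is the parameter.\<close>

lemma schoenberg_surj:
  fixes x :: "nat \<Rightarrow> real"
  assumes "\<And>k. 0 \<le> x k" "\<And>k. x k < 1"
  obtains t where "\<And>k. schoenberg k t = x k" "0 \<le> t" "t \<le> 1"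
proof -
  have "\<exists>d. (\<forall>j. d j \<in> {0, 1}) \<and> (\<lambda>j. d j / 2 ^ Suc j) sums x k" for k
    using binary_digits_exist[OF assms[of k]] by metis
  then obtain d where d: "\<And>k j. d k j \<in> {0, 1}" "\<And>k. (\<lambda>j. d k j / 2 ^ Suc j) sums x k"
    by metis
  obtain t where t: "\<And>m. schoenberg_wave (3 ^ m * t) = (case prod_decode m of (k, j) \<Rightarrow> d k j)"
    "0 \<le> t" "t \<le> 1"
  proof (rule schoenberg_wave_digits[of "\<lambda>m. case prod_decode m of (k, j) \<Rightarrow> d k j"])
    show "(case prod_decode m of (k, j) \<Rightarrow> d k j) \<in> {0, 1}" for m
      using d(1) by (simp split: prod.split)
  qed blast
  have "schoenberg k t = x k" for k
    using sums_unique[OF d(2)[of k]] by (simp add: schoenberg_def t(1))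
  then show thesis using t that by blast
qed

lemma ball_in_image_of_curve:
  fixes R :: real
  obtains g :: "real \<Rightarrow> 'a::euclidean_space"
  where "continuous_on UNIV g" "cball 0 R \<subseteq> g ` {0..1}"
proof -
  define r where "r = max R 1"
  have r: "R \<le> r" "0 < r" by (auto simp: r_def)
  obtain e :: "'a \<Rightarrow> nat" where e: "inj_on e Basis"
    using finite_imp_inj_to_nat_seg[OF finite_Basis] by blast
  \<comment> \<open>The values in [0, 1] are rescaled to [-r, 2 r] instead of [-r, r]: the ball then
    needs only values up to 2/3, which respects the strict bound \<open>x k < 1\<close> of
    \<open>schoenberg_surj\<close>.\<close>
  define g where "g t = (\<Sum>b\<in>Basis. (3 * r * schoenberg (e b) t - r) *\<^sub>R b)" for t :: real
  have "continuous_on UNIV g"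
    unfolding g_def by (intro continuous_intros continuous_on_schoenberg)
  moreover have "z \<in> g ` {0..1}" if "z \<in> cball 0 R" for z :: 'a
  proof -
    have zb: "\<bar>z \<bullet> b\<bar> \<le> r" if "b \<in> Basis" for b
      using Basis_le_norm[OF that, of z] \<open>z \<in> cball 0 R\<close> r by auto
    define x where "x k = (if k \<in> e ` Basis then (z \<bullet> inv_into Basis e k + r) / (3 * r) else 0)" for k
    have "0 \<le> x k \<and> x k < 1" for k
    proof (cases "k \<in> e ` Basis")
      case True
      then have "\<bar>z \<bullet> inv_into Basis e k\<bar> \<le> r" by (intro zb inv_into_into)
      then have "0 \<le> z \<bullet> inv_into Basis e k + r" "z \<bullet> inv_into Basis e k + r < 3 * r"
        using r by linarith+
      then show ?thesis using True r by (simp add: x_def)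
    qed (simp add: x_def)
    then obtain t where t: "\<And>k. schoenberg k t = x k" "0 \<le> t" "t \<le> 1"
      using schoenberg_surj[of x] by blast
    have "g t = (\<Sum>b\<in>Basis. (z \<bullet> b) *\<^sub>R b)"
      unfolding g_def using r e by (intro sum.cong) (auto simp: t x_def)
    then have "g t = z" by (simp add: euclidean_representation)
    then show ?thesis using t by force
  qed
  ultimately show thesis using that by blast
qed

section \<open>Weak limits of empirical measures\<close>

text \<open>The points are lifted to \<^term>\<open>{0..1::real}\<close> along a space-filling curve, so that Helly's
  selection theorem applies; the limit on the line is then pushed forward along the curve.\<close>
lemma empirical_measures_weak_limit:
  fixes z :: "nat \<Rightarrow> nat \<Rightarrow> 'a::euclidean_space"
  assumes S: "compact S" and z: "\<And>n t. z n t \<in> S"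
  obtains r \<mu> where "strict_mono r" "prob_space \<mu>" "sets \<mu> = sets borel" "AE x in \<mu>. x \<in> S"
    "\<And>f::'a \<Rightarrow> real. continuous_on UNIV f \<Longrightarrow>
       (\<lambda>n. (\<Sum>t\<le>r n. f (z (r n) t)) / Suc (r n)) \<longlonglongrightarrow> (\<integral>x. f x \<partial>\<mu>)"
proof -
  obtain R where R: "S \<subseteq> cball 0 R"
    using compact_imp_bounded[OF S] by (auto simp: bounded_iff subset_iff)
  obtain g :: "real \<Rightarrow> 'a" where g: "continuous_on UNIV g" "cball 0 R \<subseteq> g ` {0..1}"
    by (rule ball_in_image_of_curve)
  have "\<exists>s\<in>{0..1}. g s = z n t" for n t
    using g(2) R z[of n t] by (metis image_iff subset_iff)
  then obtain \<tau> where \<tau>: "\<And>n t. \<tau> n t \<in> {0..1}" "\<And>n t. g (\<tau> n t) = z n t"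
    by metis
  \<comment> \<open>Clamping leaves the lifted points unchanged and makes the composition with any
    continuous \<open>f\<close> bounded on the whole line, as weak convergence requires.\<close>
  define \<gamma> where "\<gamma> s = g (max 0 (min 1 s))" for s
  have \<gamma>_cont: "continuous_on UNIV \<gamma>"
    unfolding \<gamma>_def by (rule continuous_on_compose2[OF g(1)]) (auto intro!: continuous_intros)
  then have [measurable]: "\<gamma> \<in> borel_measurable borel"
    by (rule borel_measurable_continuous_onI)
  have \<gamma>_\<tau>: "\<gamma> (\<tau> n t) = z n t" for n t
    using \<tau>(1)[of n t] \<tau>(2)[of n t] by (simp add: \<gamma>_def)
  define M where "M n = distr (measure_pmf (pmf_of_set {..n})) borel (\<tau> n)" for n
  have M_int: "(\<integral>s. h s \<partial>M n) = (\<Sum>t\<le>n. h (\<tau> n t)) / Suc n"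
    if [measurable]: "h \<in> borel_measurable borel" for h :: "real \<Rightarrow> real" and n
    by (simp add: M_def integral_distr integral_pmf_of_set)
  have M_dist: "real_distribution (M n)" for n
  proof -
    have "prob_space (M n)"
      unfolding M_def by (intro measure_pmf.prob_space_distr) simp
    then show ?thesis
      by (simp add: real_distribution_def real_distribution_axioms_def M_def)
  qed
  have "tight M"
    unfolding tight_def
  proof (intro conjI allI impI M_dist exI)
    fix \<epsilon> :: real and n assume "0 < \<epsilon>"
    show "(-1 :: real) < 1" by simp
    have "-1 < \<tau> n t \<and> \<tau> n t \<le> 1" for t
      using \<tau>(1)[of n t] by auto
    then have "\<tau> n -` {-1<..1} = UNIV" by auto
    then have "measure (M n) {-1<..1} = 1"
      unfolding M_def by (subst measure_distr) auto
    then show "1 - \<epsilon> < measure (M n) {-1<..1}" using \<open>0 < \<epsilon>\<close> by simp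
  qed
  then obtain r N where r: "strict_mono r" and N: "real_distribution N" and conv: "weak_conv_m (M \<circ> r) N"
    using tight_imp_convergent_subsubsequence[of M id] by (auto simp: strict_mono_id)
  interpret N: real_distribution N by fact
  define \<mu> where "\<mu> = distr N borel \<gamma>"
  have lim: "(\<lambda>n. (\<Sum>t\<le>r n. f (z (r n) t)) / Suc (r n)) \<longlonglongrightarrow> (\<integral>x. f x \<partial>\<mu>)"
    if f: "continuous_on UNIV f" for f :: "'a \<Rightarrow> real"
  proof -
    have [measurable]: "f \<in> borel_measurable borel" using f by (rule borel_measurable_continuous_onI)
    have cont: "continuous_on UNIV (\<lambda>s. f (\<gamma> s))"
      by (rule continuous_on_compose2[OF f \<gamma>_cont]) auto
    have "bounded ((\<lambda>s. f (g s)) ` {0..1})"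
      by (intro compact_imp_bounded compact_continuous_image continuous_on_compose2[OF f]
          continuous_on_subset[OF g(1)]) auto
    then obtain C where C: "\<And>s. s \<in> {0..1} \<Longrightarrow> norm (f (g s)) \<le> C"
      unfolding bounded_iff by blast
    have bdd: "norm (f (\<gamma> s)) \<le> C" for s
      unfolding \<gamma>_def by (rule C) auto
    have "(\<lambda>n. \<integral>s. f (\<gamma> s) \<partial>(M \<circ> r) n) \<longlonglongrightarrow> (\<integral>s. f (\<gamma> s) \<partial>N)"
      by (rule weak_conv_imp_integral_bdd_continuous_conv[OF _ N conv _ bdd])
         (use M_dist cont in \<open>auto simp: continuous_on_eq_continuous_at\<close>)
    then show ?thesis
      by (simp add: M_int \<gamma>_\<tau> \<mu>_def integral_distr)
  qed
  have prob: "prob_space \<mu>"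
    unfolding \<mu>_def by (intro N.prob_space_distr) simp
  interpret \<mu>: prob_space \<mu> by fact
  have sets: "sets \<mu> = sets borel" by (simp add: \<mu>_def)
  have "AE x in \<mu>. x \<in> S"
  proof -
    \<comment> \<open>A test function that vanishes exactly on the closed set \<open>S\<close>: its
      empirical averages are 0, hence so is its integral in the limit. The cutoff at 1 makes it
      integrable.\<close>
    have cont: "continuous_on UNIV (\<lambda>x. min 1 (infdist x S))"
      by (intro continuous_intros)
    have [measurable]: "(\<lambda>x. min 1 (infdist x S)) \<in> borel_measurable \<mu>"
      using borel_measurable_continuous_onI[OF cont] measurable_cong_sets[OF sets refl] by blast
    have "(\<lambda>n. 0) \<longlonglongrightarrow> (\<integral>x. min 1 (infdist x S) \<partial>\<mu>)"
      using lim[OF cont] z by (simp add: infdist_zero)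
    then have "(\<integral>x. min 1 (infdist x S) \<partial>\<mu>) = 0"
      using LIMSEQ_unique tendsto_const by blast
    moreover have "integrable \<mu> (\<lambda>x. min 1 (infdist x S))"
      by (rule \<mu>.integrable_const_bound[of _ 1]) (auto simp: infdist_nonneg)
    ultimately have "AE x in \<mu>. min 1 (infdist x S) = 0"
      by (subst (asm) integral_nonneg_eq_0_iff_AE) (auto simp: infdist_nonneg)
    moreover have "S \<noteq> {}" using z by auto
    ultimately show ?thesis
      using compact_imp_closed[OF S] by (auto simp: in_closed_iff_infdist_zero min_def split: if_splits)
  qed
  with r prob sets lim show thesis using that by blast
qed

text \<open>Separability of C(K), with the dense sequence chosen inside \<open>F\<close> itself,
  because its members will have to be generators of test functions. Functions fitting the same index
  (mesh, precision, values from a countable dense set on a finite net) are uniformly close, so one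
  representative per realized index suffices.\<close>

lemma uniformly_dense_sequence_exists:
  fixes F :: "('a::metric_space \<Rightarrow> 'b::euclidean_space) set"
  assumes K: "compact K" and F: "F \<noteq> {}" and cont: "\<And>f. f \<in> F \<Longrightarrow> continuous_on K f"
  obtains D :: "nat \<Rightarrow> 'a \<Rightarrow> 'b" where "\<And>n. D n \<in> F"
    "\<And>f e. f \<in> F \<Longrightarrow> 0 < e \<Longrightarrow> \<exists>n. \<forall>x\<in>K. dist (f x) (D n x) < e"
proof -
  have "\<exists>G. finite G \<and> G \<subseteq> K \<and> K \<subseteq> (\<Union>x\<in>G. ball x (1 / Suc n))" for n
  proof -
    have "K \<subseteq> (\<Union>x\<in>K. ball x (1 / Suc n))" by force
    then obtain G where "G \<subseteq> K" "finite G" "K \<subseteq> (\<Union>x\<in>G. ball x (1 / Suc n))"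
      using compactE_image[OF K, of K "\<lambda>x. ball x (1 / Suc n)"] by (metis open_ball)
    then show ?thesis by blast
  qed
  then obtain G where G: "\<And>n. finite (G n)" "\<And>n. G n \<subseteq> K" "\<And>n. K \<subseteq> (\<Union>x\<in>G n. ball x (1 / Suc n))"
    by metis
  obtain Q :: "'b set" where Q: "countable Q" "\<And>X. open X \<Longrightarrow> X \<noteq> {} \<Longrightarrow> \<exists>q\<in>Q. q \<in> X"
    by (metis countable_dense_exists)
  define good where "good = (\<lambda>(n, m, q) f. f \<in> F \<and>
      (\<forall>x\<in>K. \<forall>y\<in>K. dist x y < 1 / Suc n \<longrightarrow> dist (f x) (f y) < 1 / Suc m) \<and>
      (\<forall>x\<in>G n. dist (f x) (q x) < 1 / Suc m))"
  define I where "I = (SIGMA n:(UNIV::nat set). SIGMA m:(UNIV::nat set). PiE (G n) (\<lambda>_. Q))"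
  \<comment> \<open>An index that no member fits gets an arbitrary member of \<open>F\<close>, so
    that every term of the sequence lies in \<open>F\<close>.\<close>
  define pick where "pick i = (if \<exists>f. good i f then (SOME f. good i f) else (SOME f. f \<in> F))" for i
  have "countable I"
    unfolding I_def using G(1) Q(1) by (intro countable_SIGMA countable_PiE) auto
  have "I \<noteq> {}"
  proof -
    obtain q where "q \<in> Q" using Q(2)[of UNIV] by auto
    then have "(0, 0, \<lambda>x\<in>G 0. q) \<in> I" by (auto simp: I_def)
    then show ?thesis by blast
  qed
  have good_pick: "good i (pick i)" if "good i f" for i f
    using someI[of "good i" f] that by (auto simp: pick_def)
  have pick_F: "pick i \<in> F" for i
  proof (cases "\<exists>f. good i f")
    case True
    then show ?thesis using good_pick by (cases i) (fastforce simp: good_def)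
  next
    case False
    then show ?thesis using F by (simp add: pick_def some_in_eq)
  qed
  have dense: "\<exists>i\<in>I. \<forall>x\<in>K. dist (f x) (pick i x) < e" if f: "f \<in> F" and e: "0 < e" for f e
  proof -
    \<comment> \<open>The 4 counts the links of the chain f x, f y, q y, pick i y, pick i x, each
      shorter than 1 / Suc m.\<close>
    obtain m where m: "4 / e < real (Suc m)"
      using reals_Archimedean2[of "4 / e"] by (metis less_trans lessI of_nat_less_iff)
    then have m4: "4 * (1 / Suc m) < e" using e by (simp add: field_simps)
    have "uniformly_continuous_on K f" using cont[OF f] K by (rule compact_uniformly_continuous)
    then obtain d where d: "0 < d" "\<And>x y. x \<in> K \<Longrightarrow> y \<in> K \<Longrightarrow> dist x y < d \<Longrightarrow> dist (f x) (f y) < 1 / Suc m"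
      unfolding uniformly_continuous_on_def by (metis of_nat_0_less_iff zero_less_Suc zero_less_divide_1_iff)
    obtain n where n: "1 / Suc n < d" using d(1) nat_approx_posE by blast
    have "\<exists>q\<in>Q. dist (f x) q < 1 / Suc m" for x
      using Q(2)[of "ball (f x) (1 / Suc m)"] by auto
    then obtain q where q: "\<And>x. q x \<in> Q" "\<And>x. dist (f x) (q x) < 1 / Suc m" by metis
    define i where "i = (n, m, restrict q (G n))"
    have "i \<in> I" using q by (auto simp: i_def I_def)
    have "good i f" using f d n q by (auto simp: good_def i_def)
    then have gp: "good i (pick i)" by (rule good_pick)
    have "dist (f x) (pick i x) < e" if xK: "x \<in> K" for x
    proof -
      obtain y where y: "y \<in> G n" "dist y x < 1 / Suc n" using G(3)[of n] xK unfolding subset_iff UN_iff mem_ball by metis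
      have "y \<in> K" using y G(2) by blast
      have "dist (f x) (pick i x) \<le> dist (f x) (f y) + dist (f y) (q y) + dist (q y) (pick i y) + dist (pick i y) (pick i x)"
        by metric
      moreover have "dist (f x) (f y) < 1 / Suc m"
        using d(2)[OF xK \<open>y \<in> K\<close>] y n by (simp add: dist_commute)
      moreover have "dist (q y) (pick i y) < 1 / Suc m" "dist (pick i y) (pick i x) < 1 / Suc m"
        using gp y xK \<open>y \<in> K\<close> by (auto simp: good_def i_def dist_commute)
      ultimately show ?thesis using q(2)[of y] m4 by linarith
    qed
    then show ?thesis using \<open>i \<in> I\<close> by blast
  qed
  show thesis
  proof (rule that)
    show "pick (from_nat_into I n) \<in> F" for n by (rule pick_F)
    show "\<exists>n. \<forall>x\<in>K. dist (f x) (pick (from_nat_into I n) x) < e" if "f \<in> F" "0 < e" for f e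
      using dense[OF that] by (metis from_nat_into_surj[OF \<open>countable I\<close>])
  qed
qed

section \<open>Online choice of points\<close>

text \<open>With \<open>S\<close> the running weighted sum of the \<open>g k (z t)\<close>, play at each step a point answering the
  combination \<open>- \<eta> * S\<close>. Then the energy \<open>\<Sum>k. w k * (S k)\<^sup>2\<close> grows by at most a constant minus
  \<open>2 / \<eta> * f (z t)\<close> per step, so that with \<open>\<eta> = 1 / sqrt T\<close> both the average of \<open>f\<close> and all averages of \<open>g k\<close> are
  controlled after \<open>T\<close> steps.\<close>
lemma averages_of_answered_combinations:
  fixes f :: "'a \<Rightarrow> real" and g :: "nat \<Rightarrow> 'a \<Rightarrow> real"
  assumes f: "\<And>x. x \<in> X \<Longrightarrow> - C \<le> f x"
    and g: "\<And>k x. x \<in> X \<Longrightarrow> \<bar>g k x\<bar> \<le> m k"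
    and answer: "\<And>a n. \<exists>x\<in>X. f x \<le> (\<Sum>k<n. a k * g k x)"
  obtains z :: "nat \<Rightarrow> nat \<Rightarrow> 'a" where "\<And>n t. z n t \<in> X"
    "\<And>n. (\<Sum>t\<le>n. f (z n t)) / Suc n \<le> 1 / sqrt (Suc n)"
    "\<And>k. (\<lambda>n. (\<Sum>t\<le>n. g k (z n t)) / Suc n) \<longlonglongrightarrow> 0"
proof -
  \<comment> \<open>Whatever the bounds \<open>m k\<close> are, these weights keep the weighted sum
    of squares of the \<open>g k x\<close> at most 1, which is the constant gained per round; the
    summand 1 keeps the denominator positive.\<close>
  define w where "w k = 1 / (2 ^ Suc k * (1 + (m k)\<^sup>2))" for k
  have w_pos: "0 < w k" for k by (simp add: w_def add_pos_nonneg)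
  have wg: "w k * (g k x)\<^sup>2 \<le> 1 / 2 ^ Suc k" if "x \<in> X" for k x
  proof -
    have "(g k x)\<^sup>2 \<le> (m k)\<^sup>2" using g[OF that, of k] by (intro abs_le_square_iff[THEN iffD1]) linarith
    then have "(g k x)\<^sup>2 / (1 + (m k)\<^sup>2) \<le> 1"
      by (subst divide_le_eq_1_pos) (auto intro: add_pos_nonneg)
    then have "(g k x)\<^sup>2 / (1 + (m k)\<^sup>2) / 2 ^ Suc k \<le> 1 / 2 ^ Suc k"
      by (intro divide_right_mono) auto
    then show ?thesis by (simp add: w_def mult.commute)
  qed
  have geo: "(\<Sum>k<N. 1 / 2 ^ Suc k :: real) \<le> 1" for N
  proof -
    have "(\<Sum>k<N. 1 / 2 ^ Suc k :: real) = 1 - 1 / 2 ^ N" by (induction N) (auto simp: field_simps)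
    then show ?thesis by simp
  qed
  have "\<exists>F. \<forall>a n. F a n \<in> X \<and> f (F a n) \<le> (\<Sum>k<n. a k * g k (F a n))"
    using answer by metis
  then obtain F where F: "\<And>a n. F a n \<in> X" "\<And>a n. f (F a n) \<le> (\<Sum>k<n. a k * g k (F a n))"
    by blast
  define \<eta> where "\<eta> n = 1 / sqrt (Suc n)" for n
  \<comment> \<open>Play number n is evaluated after Suc n rounds and watches only the functions
    with index at most n. A fixed \<open>k\<close> is watched in all plays with n >= k, which is
    enough for a limit.\<close>
  define St where "St n = rec_nat (\<lambda>k. 0) (\<lambda>t S k. S k + g k (F (\<lambda>k. - \<eta> n * w k * S k) (Suc n)))" for n
  define z where "z n t = F (\<lambda>k. - \<eta> n * w k * St n t k) (Suc n)" for n t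
  have St_0: "St n 0 k = 0" for n k by (simp add: St_def)
  have St_Suc: "St n (Suc t) k = St n t k + g k (z n t)" for n t k
    by (simp add: St_def z_def)
  have St: "St n t k = (\<Sum>s<t. g k (z n s))" for n t k
    by (induction t) (simp_all add: St_0 St_Suc)
  have zX: "z n t \<in> X" for n t by (simp add: z_def F)
  define E where "E n t = (\<Sum>k<Suc n. w k * (St n t k)\<^sup>2)" for n t
  have \<eta>_pos: "0 < \<eta> n" for n by (simp add: \<eta>_def)
  have step: "f (z n t) \<le> - \<eta> n * (\<Sum>k<Suc n. w k * St n t k * g k (z n t))" for n t
    using F(2)[of "\<lambda>k. - \<eta> n * w k * St n t k" "Suc n"]
    by (simp only: z_def sum_distrib_left mult.assoc)
  have E_step: "E n (Suc t) \<le> E n t - 2 / \<eta> n * f (z n t) + 1" for n t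
  proof -
    have "E n (Suc t) = E n t + 2 * (\<Sum>k<Suc n. w k * St n t k * g k (z n t)) + (\<Sum>k<Suc n. w k * (g k (z n t))\<^sup>2)"
      unfolding E_def St_Suc sum_distrib_left sum.distrib[symmetric]
      by (intro sum.cong refl) (simp add: power2_eq_square algebra_simps)
    also have "(\<Sum>k<Suc n. w k * (g k (z n t))\<^sup>2) \<le> (\<Sum>k<Suc n. 1 / 2 ^ Suc k)"
      by (intro sum_mono wg zX)
    also have "\<dots> \<le> 1" by (rule geo)
    also have "(\<Sum>k<Suc n. w k * St n t k * g k (z n t)) \<le> - f (z n t) / \<eta> n"
      using step[of n t] \<eta>_pos[of n] by (simp only: pos_le_divide_eq) (simp add: mult.commute)
    finally show ?thesis by simp
  qed
  \<comment> \<open>Used in two ways. Dropping the energy bounds the average of \<open>f\<close>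
    from above. Inserting the lower bound of \<open>f\<close> bounds the energy after T rounds by
    order T^(3/2), so the squared average of each \<open>g k\<close> is of order T^(-1/2).\<close>
  have E_sum: "E n t + 2 / \<eta> n * (\<Sum>s<t. f (z n s)) \<le> t" for n t
  proof (induction t)
    case 0
    then show ?case by (simp add: E_def St_0)
  next
    case (Suc t)
    then show ?case using E_step[of n t] by (simp add: algebra_simps)
  qed
  have E_nonneg: "0 \<le> E n t" for n t
    unfolding E_def by (intro sum_nonneg mult_nonneg_nonneg) (use w_pos less_imp_le in auto)
  have "(\<Sum>t\<le>n. f (z n t)) / Suc n \<le> 1 / sqrt (Suc n)" for n
  proof -
    have "2 / \<eta> n * (\<Sum>s<Suc n. f (z n s)) \<le> Suc n"
      using E_sum[of n "Suc n"] E_nonneg[of n "Suc n"] by linarith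
    then have "(\<Sum>s<Suc n. f (z n s)) \<le> Suc n * (\<eta> n / 2)"
      using \<eta>_pos[of n] by (simp add: field_simps)
    also have "\<dots> \<le> Suc n * \<eta> n" using \<eta>_pos[of n] by (intro mult_left_mono) auto
    finally show ?thesis
      by (simp add: lessThan_Suc_atMost \<eta>_def divide_le_eq mult.commute)
  qed
  moreover have "(\<lambda>n. (\<Sum>t\<le>n. g k (z n t)) / Suc n) \<longlonglongrightarrow> 0" for k
  proof -
    have bound: "((\<Sum>t\<le>n. g k (z n t)) / Suc n)\<^sup>2 \<le> (1 / Suc n + 2 * \<bar>C\<bar> * sqrt (Suc n) / Suc n) / w k"
      if "k \<le> n" for n
    proof -
      have "w k * (St n (Suc n) k)\<^sup>2 \<le> E n (Suc n)"
        unfolding E_def using that w_pos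
        by (intro member_le_sum) (auto simp: less_imp_le)
      also have "\<dots> \<le> Suc n - 2 / \<eta> n * (\<Sum>s<Suc n. f (z n s))"
        using E_sum[of n "Suc n"] by linarith
      also have "\<dots> \<le> Suc n + 2 / \<eta> n * (Suc n * \<bar>C\<bar>)"
      proof -
        have "- \<bar>C\<bar> \<le> f (z n s)" for s using f[OF zX, of n s] by linarith
        then have "(\<Sum>s<Suc n. - \<bar>C\<bar>) \<le> (\<Sum>s<Suc n. f (z n s))" by (intro sum_mono)
        then have "- (Suc n * \<bar>C\<bar>) \<le> (\<Sum>s<Suc n. f (z n s))" by simp
        then have "2 / \<eta> n * - (Suc n * \<bar>C\<bar>) \<le> 2 / \<eta> n * (\<Sum>s<Suc n. f (z n s))"
          using \<eta>_pos[of n] by (intro mult_left_mono) auto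
        then show ?thesis by simp
      qed
      finally have "w k * (St n (Suc n) k)\<^sup>2 \<le> Suc n + 2 * sqrt (Suc n) * (Suc n * \<bar>C\<bar>)"
        by (simp add: \<eta>_def)
      then have "(St n (Suc n) k)\<^sup>2 \<le> (Suc n + 2 * sqrt (Suc n) * (Suc n * \<bar>C\<bar>)) / w k"
        using w_pos[of k] by (simp add: pos_le_divide_eq mult.commute)
      then have "(St n (Suc n) k)\<^sup>2 / (Suc n)\<^sup>2 \<le> (Suc n + 2 * sqrt (Suc n) * (Suc n * \<bar>C\<bar>)) / w k / (Suc n)\<^sup>2"
        by (intro divide_right_mono) auto
      also have "\<dots> = (1 / Suc n + 2 * \<bar>C\<bar> * sqrt (Suc n) / Suc n) / w k"
      proof -
        have "(N + 2 * s * (N * c)) / v / N\<^sup>2 = (1 / N + 2 * c * s / N) / v" if "N \<noteq> 0" for N s c v :: real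
          using that by (cases "v = 0") (simp_all add: power2_eq_square field_simps)
        from this[of "real (Suc n)"] show ?thesis by simp
      qed
      finally show ?thesis
        by (simp add: St power_divide lessThan_Suc_atMost)
    qed
    have "(\<lambda>n. (1 / Suc n + 2 * \<bar>C\<bar> * sqrt (Suc n) / Suc n) / w k) \<longlonglongrightarrow> 0"
    proof -
      have "(\<lambda>n. 1 / real (Suc n)) \<longlonglongrightarrow> 0" "(\<lambda>n. sqrt (Suc n) / real (Suc n)) \<longlonglongrightarrow> 0"
        by real_asymp+
      from tendsto_divide[OF tendsto_add[OF this(1) tendsto_mult[OF tendsto_const this(2)]] tendsto_const, of "w k" "2 * \<bar>C\<bar>"]
      show ?thesis using w_pos[of k] by simp
    qed
    then have "(\<lambda>n. ((\<Sum>t\<le>n. g k (z n t)) / Suc n)\<^sup>2) \<longlonglongrightarrow> 0"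
      by (rule tendsto_sandwich[OF _ _ tendsto_const, rotated 2])
         (use bound in \<open>auto simp: eventually_sequentially\<close>)
    then have "(\<lambda>n. sqrt (((\<Sum>t\<le>n. g k (z n t)) / Suc n)\<^sup>2)) \<longlonglongrightarrow> sqrt 0"
      by (intro tendsto_intros)
    then show ?thesis by (simp only: real_sqrt_abs real_sqrt_zero tendsto_rabs_zero_iff)
  qed
  ultimately show thesis using that zX by blast
qed

section \<open>Quadratic sup-convolutions\<close>

definition sup_conv :: "real \<Rightarrow> ('a::euclidean_space \<Rightarrow> real) \<Rightarrow> 'a \<Rightarrow> real" where
  "sup_conv a u x = (SUP y. u y - a * (norm (x - y))\<^sup>2)"

text \<open>Outside the ball of radius sqrt (2 M / a) the penalty exceeds the largest possible
  oscillation 2 M of \<open>u\<close>, so the competitor y = x does better and the search for a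
  maximizer is confined to a compact ball.\<close>

lemma sup_conv_attained:
  fixes u :: "'a::euclidean_space \<Rightarrow> real"
  assumes a: "0 < a" and cont: "continuous_on UNIV u" and bound: "\<And>x. \<bar>u x\<bar> \<le> M"
  obtains y where "sup_conv a u x = u y - a * (norm (x - y))\<^sup>2"
    "\<And>y'. u y' - a * (norm (x - y'))\<^sup>2 \<le> sup_conv a u x"
    "a * (norm (x - y))\<^sup>2 \<le> 2 * M"
proof -
  let ?f = "\<lambda>y. u y - a * (norm (x - y))\<^sup>2"
  have bdd: "bdd_above (range ?f)"
  proof (rule bdd_aboveI2)
    show "?f y \<le> M" for y
      using bound[of y] mult_nonneg_nonneg[of a "(norm (x - y))\<^sup>2"] a
      by (simp add: abs_le_iff del: mult_nonneg_nonneg)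
  qed
  define r where "r = sqrt (2 * M / a)"
  have M: "0 \<le> M" using bound[of 0] by linarith
  have "0 \<le> 2 * M / a" using M a by (intro divide_nonneg_pos) auto
  then have r: "0 \<le> r" "r\<^sup>2 = 2 * M / a" by (simp_all add: r_def)
  have "\<exists>y\<in>cball x r. \<forall>y'\<in>cball x r. ?f y' \<le> ?f y"
  proof (rule continuous_attains_sup)
    show "continuous_on (cball x r) ?f"
      by (intro continuous_intros continuous_on_subset[OF cont]) auto
    show "cball x r \<noteq> {}" using r by simp
  qed simp
  then obtain y where y: "y \<in> cball x r" "\<And>y'. y' \<in> cball x r \<Longrightarrow> ?f y' \<le> ?f y" by blast
  have sq: "norm (x - y') \<le> r \<longleftrightarrow> a * (norm (x - y'))\<^sup>2 \<le> 2 * M" for y'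
  proof -
    have "norm (x - y') \<le> r \<longleftrightarrow> (norm (x - y'))\<^sup>2 \<le> 2 * M / a"
      using abs_le_square_iff[of "norm (x - y')" r] r by simp
    then show ?thesis using a by (simp add: pos_le_divide_eq mult.commute)
  qed
  have max: "?f y' \<le> ?f y" for y'
  proof (cases "y' \<in> cball x r")
    case False
    then have "2 * M < a * (norm (x - y'))\<^sup>2" using sq[of y'] by (simp add: dist_norm)
    then have "?f y' \<le> u x" using bound[of x] bound[of y'] by linarith
    also have "\<dots> \<le> ?f y" using y(2)[of x] r by simp
    finally show ?thesis .
  qed (use y in blast)
  have "sup_conv a u x = ?f y"
    unfolding sup_conv_def using max by (intro cSup_eq_maximum) auto
  then show thesis
    using that[of y] max y(1) sq[of y] by (simp add: dist_norm)
qed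

lemma sup_conv_ge:
  fixes u :: "'a::euclidean_space \<Rightarrow> real"
  assumes "0 < a" "continuous_on UNIV u" "\<And>x. \<bar>u x\<bar> \<le> M"
  shows "u y - a * (norm (x - y))\<^sup>2 \<le> sup_conv a u x"
  using sup_conv_attained[OF assms, of x] by metis

lemma sup_conv_ge_self:
  fixes u :: "'a::euclidean_space \<Rightarrow> real"
  assumes "0 < a" "continuous_on UNIV u" "\<And>x. \<bar>u x\<bar> \<le> M"
  shows "u x \<le> sup_conv a u x"
  using sup_conv_ge[OF assms, of x x] by simp

lemma sup_conv_bound:
  fixes u :: "'a::euclidean_space \<Rightarrow> real"
  assumes "0 < a" "continuous_on UNIV u" and bound: "\<And>x. \<bar>u x\<bar> \<le> M"
  shows "\<bar>sup_conv a u x\<bar> \<le> M"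
proof -
  obtain y where y: "sup_conv a u x = u y - a * (norm (x - y))\<^sup>2"
    using sup_conv_attained[OF assms, of x] by metis
  have "0 \<le> a * (norm (x - y))\<^sup>2" using assms(1) by simp
  then show ?thesis
    using y bound[of y] bound[of x] sup_conv_ge_self[OF assms, of x] by linarith
qed

lemma norm_diff_power2:
  fixes x x' y :: "'a::real_inner"
  shows "(norm (x' - y))\<^sup>2 = (norm (x - y))\<^sup>2 - 2 * ((y - x) \<bullet> (x' - x)) + (norm (x' - x))\<^sup>2"
  by (simp add: power2_norm_eq_inner inner_diff_left inner_diff_right inner_commute)

text \<open>The maximizer \<open>y\<close> for \<open>x\<close> remains a competitor at
  \<open>x'\<close>; expanding the square yields a parabola that supports the sup-convolution from
  below.\<close>

lemma sup_conv_semiconvex: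
  fixes u :: "'a::euclidean_space \<Rightarrow> real"
  assumes "0 < a" "continuous_on UNIV u" and bound: "\<And>x. \<bar>u x\<bar> \<le> M"
    and y: "sup_conv a u x = u y - a * (norm (x - y))\<^sup>2"
  shows "sup_conv a u x + (2 * a) *\<^sub>R (y - x) \<bullet> (x' - x) - a * (norm (x' - x))\<^sup>2 \<le> sup_conv a u x'"
  using sup_conv_ge[OF assms(1-3), of y x'] unfolding y norm_diff_power2[of x' y x]
  by (simp add: algebra_simps)

text \<open>The slopes of the supporting parabolas are bounded by \<open>K\<close>, since maximizers
  stay within sqrt (2 M / a). Exchanging the two points makes the one-sided estimate
  two-sided.\<close>

lemma continuous_on_sup_conv:
  fixes u :: "'a::euclidean_space \<Rightarrow> real"
  assumes a: "0 < a" and "continuous_on UNIV u" and bound: "\<And>x. \<bar>u x\<bar> \<le> M"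
  shows "continuous_on UNIV (sup_conv a u)"
proof -
  define K where "K = 2 * a * sqrt (2 * M / a)"
  have lower: "sup_conv a u x - K * norm (x' - x) - a * (norm (x' - x))\<^sup>2 \<le> sup_conv a u x'" for x x'
  proof -
    obtain y where y: "sup_conv a u x = u y - a * (norm (x - y))\<^sup>2" "a * (norm (x - y))\<^sup>2 \<le> 2 * M"
      using sup_conv_attained[OF assms, of x] by metis
    have "(norm (x - y))\<^sup>2 \<le> 2 * M / a" using y(2) a by (simp add: pos_le_divide_eq mult.commute)
    then have "norm (y - x) \<le> sqrt (2 * M / a)" by (simp add: real_le_rsqrt norm_minus_commute)
    then have "norm ((2 * a) *\<^sub>R (y - x)) \<le> K" using a by (simp add: K_def)
    then have "norm ((2 * a) *\<^sub>R (y - x)) * norm (x' - x) \<le> K * norm (x' - x)"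
      by (intro mult_right_mono) auto
    then have "- (K * norm (x' - x)) \<le> (2 * a) *\<^sub>R (y - x) \<bullet> (x' - x)"
      using Cauchy_Schwarz_ineq2[of "(2 * a) *\<^sub>R (y - x)" "x' - x"] by (simp add: abs_le_iff)
    then show ?thesis using sup_conv_semiconvex[OF assms y(1), of x'] by linarith
  qed
  have close: "\<bar>sup_conv a u x' - sup_conv a u x\<bar> \<le> K * norm (x' - x) + a * (norm (x' - x))\<^sup>2" for x x'
    using lower[of x x'] lower[of x' x] by (simp add: norm_minus_commute abs_le_iff)
  show ?thesis
    unfolding continuous_on_eq_continuous_at[OF open_UNIV] isCont_def
  proof
    fix x :: 'a
    have "((\<lambda>x'. K * norm (x' - x) + a * (norm (x' - x))\<^sup>2) \<longlongrightarrow> K * norm (x - x) + a * (norm (x - x))\<^sup>2) (at x)"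
      by (intro tendsto_intros)
    then have lim: "((\<lambda>x'. K * norm (x' - x) + a * (norm (x' - x))\<^sup>2) \<longlongrightarrow> 0) (at x)"
      by simp
    have "((\<lambda>x'. sup_conv a u x' - sup_conv a u x) \<longlongrightarrow> 0) (at x)"
      by (rule Lim_null_comparison[OF always_eventually lim]) (simp only: real_norm_def close simp_thms)
    then show "(sup_conv a u \<longlongrightarrow> sup_conv a u x) (at x)"
      by (rule Lim_null[THEN iffD2])
  qed
qed

lemma sup_conv_periodic:
  fixes u :: "'a::euclidean_space \<Rightarrow> real"
  assumes per: "\<And>y. u (y + h) = u y"
  shows "sup_conv a u (x + h) = sup_conv a u x"
proof -
  have "range (\<lambda>y. u y - a * (norm (x + h - y))\<^sup>2) = range (\<lambda>y. u y - a * (norm (x - y))\<^sup>2)"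
  proof safe
    fix y
    show "u y - a * (norm (x + h - y))\<^sup>2 \<in> range (\<lambda>y. u y - a * (norm (x - y))\<^sup>2)"
      using per[of "y - h"] by (intro image_eqI[of _ _ "y - h"]) (auto simp: algebra_simps)
    show "u y - a * (norm (x - y))\<^sup>2 \<in> range (\<lambda>y. u y - a * (norm (x + h - y))\<^sup>2)"
      using per[of y] by (intro image_eqI[of _ _ "y + h"]) (auto simp: algebra_simps)
  qed
  then show ?thesis by (simp add: sup_conv_def)
qed

text \<open>Step from \<open>x'\<close> by a vector \<open>e\<close> of length d = |x' - x| in the
  direction of r x' - r x, and expand f (x' + e) once through x' and once directly from x. The three
  expansions cost a d^2, a d^2 and a (2 d)^2, hence the 6.\<close>

lemma quadratically_approximated_imp_Lipschitz_gradient: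
  fixes f :: "'a::real_inner \<Rightarrow> real" and r :: "'a \<Rightarrow> 'a"
  assumes approx: "\<And>x x'. \<bar>f x' - f x - r x \<bullet> (x' - x)\<bar> \<le> a * (norm (x' - x))\<^sup>2"
  shows "norm (r x' - r x) \<le> 6 * a * norm (x' - x)"
proof (cases "r x' = r x")
  case True
  have "0 \<le> a * (norm (x' - x))\<^sup>2" using approx[of x' x] by linarith
  then show ?thesis using True by (cases "x' = x") (auto simp: zero_le_mult_iff)
next
  case False
  then have ne: "x' \<noteq> x" by auto
  define d where "d = norm (x' - x)"
  define e where "e = (d / norm (r x' - r x)) *\<^sub>R (r x' - r x)"
  have d: "0 < d" using ne by (simp add: d_def)
  have ne: "norm e = d" using False d by (simp add: e_def)
  have a: "0 \<le> a"
    using order_trans[OF abs_ge_zero approx[of x' x]] d by (simp add: d_def zero_le_mult_iff)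
  have "(r x' - r x) \<bullet> e = d * norm (r x' - r x)"
    using False by (simp add: e_def dot_square_norm power2_eq_square)
  moreover have "(r x' - r x) \<bullet> e \<le> 6 * a * d\<^sup>2"
  proof -
    have 1: "f (x' + e) \<ge> f x' + r x' \<bullet> e - a * d\<^sup>2"
      using approx[of "x' + e" x'] ne by (simp add: abs_le_iff)
    have 2: "f x' \<ge> f x + r x \<bullet> (x' - x) - a * d\<^sup>2"
      using approx[of x' x] by (simp add: abs_le_iff d_def)
    have "norm (x' + e - x) \<le> norm (x' - x) + norm e"
      using norm_triangle_ineq[of "x' - x" e] by (simp add: algebra_simps)
    then have "norm (x' + e - x) \<le> 2 * d" by (simp add: ne d_def)
    then have "(norm (x' + e - x))\<^sup>2 \<le> (2 * d)\<^sup>2" by (intro power_mono) auto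
    then have "a * (norm (x' + e - x))\<^sup>2 \<le> a * (2 * d)\<^sup>2" using a by (rule mult_left_mono)
    then have 3: "f (x' + e) \<le> f x + r x \<bullet> (x' + e - x) + 4 * a * d\<^sup>2"
      using approx[of "x' + e" x] by (simp add: abs_le_iff power_mult_distrib)
    have "r x \<bullet> (x' + e - x) = r x \<bullet> (x' - x) + r x \<bullet> e"
      by (simp add: inner_add_right inner_diff_right)
    then show ?thesis using 1 2 3 by (simp add: inner_diff_left)
  qed
  ultimately have "d * norm (r x' - r x) \<le> d * (6 * a * d)"
    by (simp add: power2_eq_square algebra_simps)
  then show ?thesis using d by (simp add: d_def)
qed

lemma quadratically_approximated_imp_has_derivative:
  fixes f :: "'a::real_inner \<Rightarrow> real"
  assumes approx: "\<And>x'. \<bar>f x' - f x - r \<bullet> (x' - x)\<bar> \<le> a * (norm (x' - x))\<^sup>2"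
  shows "(f has_derivative (\<lambda>h. r \<bullet> h)) (at x)"
  unfolding has_derivative_at
proof (intro conjI bounded_linear_inner_right)
  have lim: "((\<lambda>h. a * norm h) \<longlongrightarrow> 0) (at (0::'a))"
    by (intro tendsto_mult_right_zero tendsto_norm_zero tendsto_ident_at)
  show "(\<lambda>h. norm (f (x + h) - f x - r \<bullet> h) / norm h) \<midarrow>0\<rightarrow> 0"
  proof (rule Lim_null_comparison[OF always_eventually lim], rule allI)
    fix h :: 'a
    show "norm (norm (f (x + h) - f x - r \<bullet> h) / norm h) \<le> a * norm h"
      using approx[of "x + h"] by (cases "h = 0") (simp_all add: divide_le_eq power2_eq_square mult.assoc)
  qed
qed

lemma nonpos_if_le_small_multiples:
  fixes X Y :: real
  assumes "\<And>t. 0 < t \<Longrightarrow> t < 1 \<Longrightarrow> Y \<le> t * X"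
  shows "Y \<le> 0"
proof (rule tendsto_lowerbound)
  show "((\<lambda>t. t * X) \<longlongrightarrow> 0) (at_right 0)"
    by (intro tendsto_mult_left_zero tendsto_ident_at)
  show "\<forall>\<^sub>F t in at_right 0. Y \<le> t * X"
    using assms by (auto simp: eventually_at_right_field intro!: exI[of _ 1])
qed simp

text \<open>The two minus signs turn the outer sup-convolution into an inf-convolution. The inner
  parameter is smaller than the outer one so that the infimum preserves semiconvexity; the ratio 1/2
  yields the same constant \<open>a\<close> in the quadratic bounds from above and below.\<close>

definition lasry_lions :: "real \<Rightarrow> ('a::euclidean_space \<Rightarrow> real) \<Rightarrow> 'a \<Rightarrow> real" where
  "lasry_lions a u x = - sup_conv a (\<lambda>y. - sup_conv (a/2) u y) x"

lemma lasry_lions_periodic: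
  fixes u :: "'a::euclidean_space \<Rightarrow> real"
  assumes "\<And>y. u (y + h) = u y"
  shows "lasry_lions a u (x + h) = lasry_lions a u x"
  unfolding lasry_lions_def by (intro arg_cong[where f = uminus] sup_conv_periodic) (rule assms)

text \<open>The second property carries information about viscosity subsolutions, available only at points
  \<open>y\<close> touched from above by a parabola, over to the gradient \<open>r\<close>.\<close>
lemma lasry_lions_gradient:
  fixes u :: "'a::euclidean_space \<Rightarrow> real"
  assumes a: "0 < a" and u: "continuous_on UNIV u" and bound: "\<And>x. \<bar>u x\<bar> \<le> M"
  obtains r where
    "\<And>x x'. \<bar>lasry_lions a u x' - lasry_lions a u x - r x \<bullet> (x' - x)\<bar> \<le> a * (norm (x' - x))\<^sup>2"
    "\<And>x v t. 0 < t \<Longrightarrow> \<exists>y z. (\<forall>y'. u y' - a/2 * (norm (z - y'))\<^sup>2 \<le> u y - a/2 * (norm (z - y))\<^sup>2) \<and>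
      norm (y - x) \<le> 2 * sqrt (4 * M / a) + t * norm v \<and>
      r x \<bullet> v \<le> a *\<^sub>R (y - z) \<bullet> v + 3/2 * a * t * (norm v)\<^sup>2"
    "\<And>x. \<exists>y. norm (y - x) \<le> sqrt (4 * M / a) \<and> u y \<le> lasry_lions a u x"
    "\<And>x. \<exists>y. norm (y - x) \<le> sqrt (4 * M / a) \<and> lasry_lions a u x \<le> u y"
proof -
  let ?w = "sup_conv (a/2) u" and ?f = "lasry_lions a u"
  have a2: "0 < a/2" using a by simp
  have M: "0 \<le> M" using bound[of 0] by linarith
  have w_cont: "continuous_on UNIV (\<lambda>y. - ?w y)"
    by (intro continuous_intros continuous_on_sup_conv[OF a2 u bound])
  have w_bound: "\<bar>- ?w y\<bar> \<le> M" for y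
    using sup_conv_bound[OF a2 u bound] by simp
  have near: "norm (y - x) \<le> sqrt (4 * M / a)" if "a/2 * (norm (x - y))\<^sup>2 \<le> 2 * M" for x y :: 'a
    using that a by (intro real_le_rsqrt) (simp add: norm_minus_commute field_simps)
  have "\<exists>y. sup_conv a (\<lambda>y. - ?w y) x = - ?w y - a * (norm (x - y))\<^sup>2 \<and>
      (\<forall>y'. - ?w y' - a * (norm (x - y'))\<^sup>2 \<le> sup_conv a (\<lambda>y. - ?w y) x) \<and> a * (norm (x - y))\<^sup>2 \<le> 2 * M" for x
    using sup_conv_attained[OF a w_cont w_bound, of x] by metis
  then obtain m where m': "\<And>x. sup_conv a (\<lambda>y. - ?w y) x = - ?w (m x) - a * (norm (x - m x))\<^sup>2"
    "\<And>x y. - ?w y - a * (norm (x - y))\<^sup>2 \<le> sup_conv a (\<lambda>y. - ?w y) x" "\<And>x. a * (norm (x - m x))\<^sup>2 \<le> 2 * M"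
    by metis
  have m: "?f x = ?w (m x) + a * (norm (x - m x))\<^sup>2" "?f x \<le> ?w y + a * (norm (x - y))\<^sup>2" for x y
    using m'(1)[of x] m'(2)[of y x] by (simp_all add: lasry_lions_def)
  have m_near: "norm (m x - x) \<le> sqrt (4 * M / a)" for x
  proof (rule near)
    have "a/2 * (norm (x - m x))\<^sup>2 \<le> a * (norm (x - m x))\<^sup>2" using a by (intro mult_right_mono) auto
    then show "a/2 * (norm (x - m x))\<^sup>2 \<le> 2 * M" using m'(3)[of x] by linarith
  qed
  \<comment> \<open>The slope at \<open>x\<close> of the parabola that touches the regularization
    from above; it is also the slope at \<open>m x\<close> of a parabola touching the inner
    sup-convolution from below.\<close>
  define r where "r x = (2 * a) *\<^sub>R (x - m x)" for x
  have semi: "\<exists>y. (\<forall>y'. u y' - a/2 * (norm (z - y'))\<^sup>2 \<le> u y - a/2 * (norm (z - y))\<^sup>2) \<and> norm (y - z) \<le> sqrt (4 * M / a) \<and>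
      (\<forall>z'. ?w z + a *\<^sub>R (y - z) \<bullet> (z' - z) - a/2 * (norm (z' - z))\<^sup>2 \<le> ?w z')" for z
  proof -
    obtain y where y: "?w z = u y - a/2 * (norm (z - y))\<^sup>2"
      "\<And>y'. u y' - a/2 * (norm (z - y'))\<^sup>2 \<le> ?w z" "a/2 * (norm (z - y))\<^sup>2 \<le> 2 * M"
      using sup_conv_attained[OF a2 u bound, of z] by metis
    have "?w z + a *\<^sub>R (y - z) \<bullet> (z' - z) - a/2 * (norm (z' - z))\<^sup>2 \<le> ?w z'" for z'
      using sup_conv_semiconvex[OF a2 u bound y(1), of z'] by simp
    then show ?thesis using y near by metis
  qed
  have touch: "?w (m x) + r x \<bullet> d - a * (norm d)\<^sup>2 \<le> ?w (m x + d)" for x d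
  proof -
    have expand: "(norm (x - (m x + d)))\<^sup>2 = (norm (x - m x))\<^sup>2 - 2 * ((x - m x) \<bullet> d) + (norm d)\<^sup>2"
      by (simp add: power2_norm_eq_inner inner_diff_left inner_diff_right inner_add_left inner_add_right inner_commute)
    show ?thesis
      using m(2)[of x "m x + d"] unfolding m(1)[of x] r_def expand by (simp add: algebra_simps)
  qed
  \<comment> \<open>Semiconvexity halves the coefficient in \<open>touch\<close>; with the full
    coefficient the lower bound derived later would be unbounded in the displacement
    \<open>d\<close>. A parabola supporting the sup-convolution at m x + t d is evaluated at both
    ends of the segment, the weights 1 - t and t eliminate its unknown slope, and
    \<open>touch\<close> controls the value at the intermediate point. Then divide by t and let t
    tend to 0.\<close>
  have touch': "?w (m x) + r x \<bullet> d - a/2 * (norm d)\<^sup>2 \<le> ?w (m x + d)" for x d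
  proof -
    define D where "D = a/2 * (norm d)\<^sup>2"
    have "?w (m x) + r x \<bullet> d - D - ?w (m x + d) \<le> t * D" if t: "0 < t" "t < 1" for t
    proof -
      obtain y where y: "\<And>z'. ?w (m x + t *\<^sub>R d) + a *\<^sub>R (y - (m x + t *\<^sub>R d)) \<bullet> (z' - (m x + t *\<^sub>R d))
          - a/2 * (norm (z' - (m x + t *\<^sub>R d)))\<^sup>2 \<le> ?w z'"
        using semi[of "m x + t *\<^sub>R d"] by metis
      define p where "p = a *\<^sub>R (y - (m x + t *\<^sub>R d)) \<bullet> d"
      define W where "W = ?w (m x + t *\<^sub>R d)"
      have "W - t * p - t\<^sup>2 * D \<le> ?w (m x)"
        using y[of "m x"] by (simp add: W_def p_def D_def power_mult_distrib mult_ac)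
      moreover have "W + (1 - t) * p - (1 - t)\<^sup>2 * D \<le> ?w (m x + d)"
      proof -
        have "m x + d - (m x + t *\<^sub>R d) = (1 - t) *\<^sub>R d" by (simp add: algebra_simps)
        then show ?thesis
          using y[of "m x + d"] by (simp add: W_def p_def D_def power_mult_distrib mult_ac)
      qed
      ultimately have "(1 - t) * (W - t * p - t\<^sup>2 * D) + t * (W + (1 - t) * p - (1 - t)\<^sup>2 * D)
          \<le> (1 - t) * ?w (m x) + t * ?w (m x + d)"
        using t by (intro add_mono mult_left_mono) auto
      moreover have "(1 - t) * (W - t * p - t\<^sup>2 * D) + t * (W + (1 - t) * p - (1 - t)\<^sup>2 * D) = W - t * (1 - t) * D"
        by (simp add: power2_eq_square algebra_simps)
      moreover have "?w (m x) + t * (r x \<bullet> d) - 2 * t\<^sup>2 * D \<le> W"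
        using touch[of x "t *\<^sub>R d"] by (simp add: W_def D_def power_mult_distrib mult_ac)
      ultimately have "t * (?w (m x) + r x \<bullet> d - D - ?w (m x + d)) \<le> t * (t * D)"
        by (simp add: power2_eq_square algebra_simps)
      then show ?thesis using t by simp
    qed
    from nonpos_if_le_small_multiples[OF this] show ?thesis by (simp add: D_def)
  qed
  show thesis
  proof (rule that)
    show "\<bar>?f x' - ?f x - r x \<bullet> (x' - x)\<bar> \<le> a * (norm (x' - x))\<^sup>2" for x x'
    proof -
      have expand: "a * (norm (x + s - (m x + d)))\<^sup>2 = a * (norm (x - m x))\<^sup>2 + r x \<bullet> (s - d) + a * (norm (s - d))\<^sup>2" for s d
        by (simp add: r_def power2_norm_eq_inner inner_diff_left inner_diff_right inner_add_left inner_add_right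
            inner_commute algebra_simps)
      have "?f x' \<le> ?f x + r x \<bullet> (x' - x) + a * (norm (x' - x))\<^sup>2"
        using m(2)[of x' "m x"] expand[of "x' - x" 0] by (simp add: m(1)[of x])
      moreover have "?f x + r x \<bullet> (x' - x) - a * (norm (x' - x))\<^sup>2 \<le> ?f x'"
      proof -
        define s d where "s = x' - x" and "d = m x' - m x"
        \<comment> \<open>The displacement \<open>d\<close> of the minimizers is not controlled;
          this square absorbs it, using the gap between the parameters a and a/2.\<close>
        have "0 \<le> a/2 * (norm (d - 2 *\<^sub>R s))\<^sup>2" using a by simp
        also have "\<dots> = a * (norm (s - d))\<^sup>2 - a/2 * (norm d)\<^sup>2 + a * (norm s)\<^sup>2"
          by (simp add: power2_norm_eq_inner inner_diff_left inner_diff_right inner_commute algebra_simps)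
        finally have "- (a * (norm s)\<^sup>2) \<le> a * (norm (s - d))\<^sup>2 - a/2 * (norm d)\<^sup>2" by linarith
        moreover have "?f x' = ?w (m x + d) + a * (norm (x + s - (m x + d)))\<^sup>2"
          by (simp add: m(1)[of x'] s_def d_def)
        ultimately show ?thesis
          using touch'[of x d] expand[of s d] m(1)[of x] unfolding s_def[symmetric] by (simp add: inner_diff_right)
      qed
      ultimately show ?thesis by (simp add: abs_le_iff)
    qed
    show "\<exists>y z. (\<forall>y'. u y' - a/2 * (norm (z - y'))\<^sup>2 \<le> u y - a/2 * (norm (z - y))\<^sup>2) \<and>
      norm (y - x) \<le> 2 * sqrt (4 * M / a) + t * norm v \<and>
      r x \<bullet> v \<le> a *\<^sub>R (y - z) \<bullet> v + 3/2 * a * t * (norm v)\<^sup>2" if t: "0 < t" for x v t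
    proof -
      \<comment> \<open>At \<open>m x\<close> itself the slope \<open>r x\<close> may be a mixture
        of the slopes of several maximizers. After a small shift in direction \<open>v\<close>, the
        slope belonging to any one maximizer dominates \<open>r x\<close> along \<open>v\<close> up
        to O(t), because slopes of a semiconvex function are almost monotone.\<close>
      define z where "z = m x + t *\<^sub>R v"
      obtain y where y: "\<And>y'. u y' - a/2 * (norm (z - y'))\<^sup>2 \<le> u y - a/2 * (norm (z - y))\<^sup>2"
        "norm (y - z) \<le> sqrt (4 * M / a)"
        "\<And>z'. ?w z + a *\<^sub>R (y - z) \<bullet> (z' - z) - a/2 * (norm (z' - z))\<^sup>2 \<le> ?w z'"
        using semi[of z] by metis
      have "norm (y - x) \<le> norm (y - z) + norm (m x - x) + norm (t *\<^sub>R v)"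
        using norm_triangle_ineq[of "y - z" "m x - x + t *\<^sub>R v"] norm_triangle_ineq[of "m x - x" "t *\<^sub>R v"]
        by (simp add: z_def)
      then have "norm (y - x) \<le> 2 * sqrt (4 * M / a) + t * norm v"
        using y(2) m_near[of x] t by simp
      moreover have "r x \<bullet> v \<le> a *\<^sub>R (y - z) \<bullet> v + 3/2 * a * t * (norm v)\<^sup>2"
      proof -
        define p V where "p = a *\<^sub>R (y - z) \<bullet> v" and "V = a/2 * (norm v)\<^sup>2"
        have "?w z - t * p - t\<^sup>2 * V \<le> ?w (m x)"
          using y(3)[of "m x"] t by (simp add: z_def p_def V_def power_mult_distrib mult_ac)
        moreover have "?w (m x) + t * (r x \<bullet> v) - 2 * t\<^sup>2 * V \<le> ?w z"
          using touch[of x "t *\<^sub>R v"] by (simp add: z_def V_def power_mult_distrib mult_ac)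
        ultimately have "t * (r x \<bullet> v) \<le> t * (p + 3 * t * V)"
          by (simp add: power2_eq_square algebra_simps)
        then have "r x \<bullet> v \<le> p + 3 * t * V" using t by simp
        then show ?thesis by (simp add: p_def V_def mult_ac)
      qed
      ultimately show ?thesis using y(1) by blast
    qed
    show "\<exists>y. norm (y - x) \<le> sqrt (4 * M / a) \<and> u y \<le> ?f x" for x
    proof (intro exI conjI)
      have "u (m x) \<le> ?w (m x)" by (rule sup_conv_ge_self[OF a2 u bound])
      also have "\<dots> \<le> ?f x" using a by (simp add: m(1))
      finally show "u (m x) \<le> ?f x" .
    qed (rule m_near)
    show "\<exists>y. norm (y - x) \<le> sqrt (4 * M / a) \<and> ?f x \<le> u y" for x
    proof -
      obtain y where y: "?w x = u y - a/2 * (norm (x - y))\<^sup>2" "a/2 * (norm (x - y))\<^sup>2 \<le> 2 * M"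
        using sup_conv_attained[OF a2 u bound, of x] by metis
      have "?f x \<le> ?w x" using m(2)[of x x] by simp
      also have "\<dots> \<le> u y" using a by (simp add: y(1))
      finally show ?thesis using near[OF y(2)] by blast
    qed
  qed
qed

section \<open>Periodic functions\<close>

definition frac_vec :: "real^'n \<Rightarrow> real^'n" where
  "frac_vec x = (\<chi> k. frac (x $ k))"

lemma frac_vec_shift: "frac_vec x + int_shift (\<chi> k. \<lfloor>x $ k\<rfloor>) = x"
  by (simp add: frac_vec_def int_shift_def vec_eq_iff frac_def)

lemma frac_vec_fund_domain: "frac_vec x \<in> fund_domain"
  by (simp add: frac_vec_def fund_domain_def frac_lt_1)

lemma frac_vec_cbox: "frac_vec x \<in> cbox 0 1"
  by (simp add: frac_vec_def mem_box_cart less_imp_le[OF frac_lt_1])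

lemma periodic_fun_frac_vec: "periodic_fun f \<Longrightarrow> f (frac_vec x) = f x"
  using frac_vec_shift[of x] unfolding periodic_fun_def by metis

lemma periodic_bounded:
  fixes F :: "real^'n \<Rightarrow> 'b::metric_space \<Rightarrow> real"
  assumes cont: "continuous_on UNIV (\<lambda>(x, p). F x p)" and per: "\<And>p. periodic_fun (\<lambda>x. F x p)"
    and P: "compact P"
  obtains C where "\<And>x p. p \<in> P \<Longrightarrow> \<bar>F x p\<bar> \<le> C"
proof -
  have "compact ((\<lambda>(x, p). F x p) ` (cbox 0 1 \<times> P))"
    using cont P by (intro compact_continuous_image compact_Times) (auto intro: continuous_on_subset)
  then have "bounded ((\<lambda>(x, p). F x p) ` (cbox 0 1 \<times> P))" by (rule compact_imp_bounded)
  then obtain C where C: "\<And>y. y \<in> (\<lambda>(x, p). F x p) ` (cbox 0 1 \<times> P) \<Longrightarrow> norm y \<le> C"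
    unfolding bounded_iff by blast
  have "\<bar>F x p\<bar> \<le> C" if "p \<in> P" for x p
  proof -
    have "(\<lambda>(x, p). F x p) (frac_vec x, p) \<in> (\<lambda>(x, p). F x p) ` (cbox 0 1 \<times> P)"
      using frac_vec_cbox[of x] that by (intro imageI) auto
    then show ?thesis
      using C[of "F (frac_vec x) p"] periodic_fun_frac_vec[OF per, of x p] by simp
  qed
  then show thesis using that by blast
qed

text \<open>A lattice shift brings \<open>x\<close> into the unit cube, and points at distance below
  1 from it then lie in the compact cube between -1 and 2. The parameter \<open>p\<close> is the
  momentum of a Hamiltonian; functions of \<open>x\<close> alone are treated with the dummy set
  {0}.\<close>

lemma periodic_uniformly_continuous:
  fixes F :: "real^'n \<Rightarrow> 'b::metric_space \<Rightarrow> real"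
  assumes cont: "continuous_on UNIV (\<lambda>(x, p). F x p)" and per: "\<And>p. periodic_fun (\<lambda>x. F x p)"
    and P: "compact P" and e: "0 < e"
  obtains d where "0 < d" "\<And>x y p. p \<in> P \<Longrightarrow> norm (x - y) < d \<Longrightarrow> \<bar>F x p - F y p\<bar> < e"
proof -
  let ?Q = "cbox (-1) 2 :: (real^'n) set"
  have "uniformly_continuous_on (?Q \<times> P) (\<lambda>(x, p). F x p)"
    using cont P by (intro compact_uniformly_continuous compact_Times) (auto intro: continuous_on_subset)
  then obtain d where d: "0 < d"
    "\<And>w w'. w \<in> ?Q \<times> P \<Longrightarrow> w' \<in> ?Q \<times> P \<Longrightarrow> dist w' w < d \<Longrightarrow>
      dist ((\<lambda>(x, p). F x p) w') ((\<lambda>(x, p). F x p) w) < e"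
    using e unfolding uniformly_continuous_on_def by metis
  have "\<bar>F x p - F y p\<bar> < e" if p: "p \<in> P" and xy: "norm (x - y) < min d 1" for x y p
  proof -
    let ?z = "int_shift (\<chi> k. \<lfloor>x $ k\<rfloor>)"
    have per': "F w p = F (w - ?z) p" for w
      using per[of p] unfolding periodic_fun_def by (metis diff_add_cancel)
    have x: "x - ?z = frac_vec x" using frac_vec_shift[of x] by (metis add_diff_cancel_right')
    have "x - ?z \<in> ?Q" "y - ?z \<in> ?Q"
    proof -
      define x' y' where "x' = x - ?z" and "y' = y - ?z"
      have f01: "0 \<le> x' $ k \<and> x' $ k \<le> 1" for k
        unfolding x'_def x using frac_vec_cbox[of x] by (simp add: mem_box_cart)
      have near: "\<bar>x' $ k - y' $ k\<bar> \<le> 1" for k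
        using component_le_norm_cart[of "x - y" k] xy by (simp add: x'_def y'_def)
      have bounds: "-1 \<le> x' $ k \<and> x' $ k \<le> 2 \<and> -1 \<le> y' $ k \<and> y' $ k \<le> 2" for k
        using f01[of k] near[of k] by auto
      show "x - ?z \<in> ?Q" "y - ?z \<in> ?Q"
        unfolding mem_box_cart x'_def[symmetric] y'_def[symmetric] using bounds by simp_all
    qed
    then have "dist (F (x - ?z) p) (F (y - ?z) p) < e"
      using d(2)[of "(y - ?z, p)" "(x - ?z, p)"] p xy by (simp add: dist_norm dist_Pair_Pair)
    then show ?thesis using per'[of x] per'[of y] by (simp add: dist_norm)
  qed
  then show thesis using that[of "min d 1"] d(1) by simp
qed

lemma periodic_fun_gradient:
  fixes phi :: "real^'n \<Rightarrow> real"
  assumes "periodic_fun phi" "C1_grad phi Dphi"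
  shows "periodic_fun Dphi"
  unfolding periodic_fun_def
proof (intro allI)
  fix x :: "real^'n" and z :: "int^'n"
  let ?s = "int_shift z"
  have "(phi has_derivative (\<lambda>h. Dphi (x + ?s) \<bullet> h)) (at (x + ?s))"
    using assms(2) by (simp add: C1_grad_def)
  then have "((\<lambda>y. phi (y + ?s)) has_derivative (\<lambda>h. Dphi (x + ?s) \<bullet> h)) (at x)"
    by (rule has_derivative_compose[rotated]) (auto intro!: derivative_eq_intros)
  then have "(phi has_derivative (\<lambda>h. Dphi (x + ?s) \<bullet> h)) (at x)"
    using assms(1) by (simp add: periodic_fun_def)
  moreover have "(phi has_derivative (\<lambda>h. Dphi x \<bullet> h)) (at x)"
    using assms(2) by (simp add: C1_grad_def)
  ultimately have "(\<lambda>h. Dphi (x + ?s) \<bullet> h) = (\<lambda>h. Dphi x \<bullet> h)"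
    by (rule has_derivative_unique)
  then have "Dphi (x + ?s) \<bullet> h = Dphi x \<bullet> h" for h by meson
  then show "Dphi (x + ?s) = Dphi x" using vector_eq_rdot by blast
qed

lemma C1_grad_parabola: "C1_grad (\<lambda>y. a/2 * (norm (z - y))\<^sup>2) (\<lambda>y. a *\<^sub>R (y - z))"
  unfolding C1_grad_def power2_norm_eq_inner
  by (auto intro!: continuous_intros derivative_eq_intros
      simp: fun_eq_iff inner_diff_left inner_diff_right inner_commute algebra_simps)

section \<open>The coupled system\<close>

locale coupled_system =
  fixes H :: "'m::finite \<Rightarrow> real^'n \<Rightarrow> real^'n \<Rightarrow> real"
    and B :: "'m \<Rightarrow> 'm \<Rightarrow> real"
    and \<alpha> :: "real \<Rightarrow> real"
    and c :: real
    and u :: "'m \<Rightarrow> real^'n \<Rightarrow> real"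
  assumes H_cont: "\<And>i. continuous_on UNIV (\<lambda>(x, p). H i x p)"
    and H_per: "\<And>i p. periodic_fun (\<lambda>x. H i x p)"
    and H_conv: "\<And>i x. convex_on UNIV (H i x)"
    and H_lower: "\<And>i x p. \<alpha> (norm p) \<le> H i x p"
    and \<alpha>_sl: "superlinear \<alpha>"
    and B: "coupling_matrix B"
    and crit: "visc_sol H B c u"
begin

abbreviation "L \<equiv> lagrangian H"

definition coupling :: "('m \<Rightarrow> real^'n \<Rightarrow> real) \<Rightarrow> 'm \<Rightarrow> real^'n \<Rightarrow> real" where
  "coupling f i x = (\<Sum>j\<in>UNIV. B i j * f j x)"

lemma u_cont: "continuous_on UNIV (u i)" and u_per: "periodic_fun (u i)"
  using crit by (auto simp: visc_sol_def)

lemma H_bounded: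
  obtains C where "\<And>i x p. norm p \<le> K \<Longrightarrow> \<bar>H i x p\<bar> \<le> C"
proof -
  have "\<exists>C. \<forall>x. \<forall>p\<in>cball 0 K. \<bar>H i x p\<bar> \<le> C" for i
    using periodic_bounded[OF H_cont[of i] H_per compact_cball] by metis
  then obtain C where C: "\<And>i x p. p \<in> cball 0 K \<Longrightarrow> \<bar>H i x p\<bar> \<le> C i" by metis
  have "\<bar>H i x p\<bar> \<le> Max (range C)" if "norm p \<le> K" for i x p
    by (rule order_trans[OF C Max_ge]) (use that in auto)
  then show thesis using that by blast
qed

lemma H_uniformly_continuous:
  assumes e: "0 < e"
  obtains d where "0 < d"
    "\<And>i x y p. norm p \<le> K \<Longrightarrow> norm (x - y) < d \<Longrightarrow> \<bar>H i x p - H i y p\<bar> < e"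
proof -
  have "\<exists>d>0. \<forall>x y. \<forall>p\<in>cball 0 K. norm (x - y) < d \<longrightarrow> \<bar>H i x p - H i y p\<bar> < e" for i
    using periodic_uniformly_continuous[OF H_cont[of i] H_per compact_cball e] by metis
  then obtain d where d: "\<And>i. 0 < d i"
    "\<And>i x y p. p \<in> cball 0 K \<Longrightarrow> norm (x - y) < d i \<Longrightarrow> \<bar>H i x p - H i y p\<bar> < e" by metis
  have "0 < Min (range d)" using d(1) by simp
  moreover have "Min (range d) \<le> d i" for i by simp
  ultimately show thesis using that[of "Min (range d)"] d(2) by (meson less_le_trans mem_cball_0)
qed

lemma u_bounded:
  obtains M where "\<And>i x. \<bar>u i x\<bar> \<le> M"
proof -
  have "\<exists>C. \<forall>x. \<bar>u i x\<bar> \<le> C" for i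
  proof -
    have "continuous_on UNIV (\<lambda>(x, p::real). u i x)"
      unfolding split_beta by (intro continuous_on_compose2[OF u_cont]) (auto intro!: continuous_intros)
    then obtain C where "\<And>x p::real. p \<in> {0} \<Longrightarrow> \<bar>u i x\<bar> \<le> C"
      using periodic_bounded[of "\<lambda>x p::real. u i x" "{0}"] u_per[of i] by auto
    then show ?thesis by auto
  qed
  then obtain C where C: "\<And>i x. \<bar>u i x\<bar> \<le> C i" by metis
  have "\<bar>u i x\<bar> \<le> Max (range C)" for i x
    by (rule order_trans[OF C Max_ge]) auto
  then show thesis using that by blast
qed

lemma u_uniformly_continuous:
  assumes e: "0 < e"
  obtains d where "0 < d" "\<And>i x y. norm (x - y) < d \<Longrightarrow> \<bar>u i x - u i y\<bar> < e"
proof -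
  have "\<exists>d>0. \<forall>x y. norm (x - y) < d \<longrightarrow> \<bar>u i x - u i y\<bar> < e" for i
  proof -
    have "continuous_on UNIV (\<lambda>(x, p::real). u i x)"
      unfolding split_beta by (intro continuous_on_compose2[OF u_cont]) (auto intro!: continuous_intros)
    then obtain d where "0 < d" "\<And>x y p::real. p \<in> {0} \<Longrightarrow> norm (x - y) < d \<Longrightarrow> \<bar>u i x - u i y\<bar> < e"
      using periodic_uniformly_continuous[of "\<lambda>x p::real. u i x" "{0}"] u_per[of i] e by auto
    then show ?thesis by auto
  qed
  then obtain d where d: "\<And>i. 0 < d i"
    "\<And>i x y. norm (x - y) < d i \<Longrightarrow> \<bar>u i x - u i y\<bar> < e" by metis
  have "0 < Min (range d)" using d(1) by simp
  moreover have "Min (range d) \<le> d i" for i by simp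
  ultimately show thesis using that[of "Min (range d)"] d(2) by (meson less_le_trans)
qed

definition B_norm :: real where
  "B_norm = (\<Sum>i\<in>UNIV. \<Sum>j\<in>UNIV. \<bar>B i j\<bar>)"

lemma B_norm_nonneg: "0 \<le> B_norm"
  unfolding B_norm_def by (intro sum_nonneg) auto

lemma coupling_diff_le:
  assumes "\<And>j. \<bar>f j x - g j y\<bar> \<le> e"
  shows "\<bar>coupling f i x - coupling g i y\<bar> \<le> B_norm * e"
proof -
  have e: "0 \<le> e" using assms[of undefined] by linarith
  have "\<bar>coupling f i x - coupling g i y\<bar> = \<bar>\<Sum>j\<in>UNIV. B i j * (f j x - g j y)\<bar>"
    by (simp add: coupling_def sum_subtractf algebra_simps)
  also have "\<dots> \<le> (\<Sum>j\<in>UNIV. \<bar>B i j\<bar> * e)"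
    by (rule order_trans[OF sum_abs]) (auto intro!: sum_mono mult_left_mono assms simp: abs_mult)
  also have "\<dots> \<le> B_norm * e"
    unfolding B_norm_def sum_distrib_right[symmetric]
    by (intro mult_right_mono e member_le_sum[of i _ "\<lambda>i. \<Sum>j\<in>UNIV. \<bar>B i j\<bar>"]) (auto intro: sum_nonneg)
  finally show ?thesis .
qed

lemma coupling_u_bounded:
  obtains C where "\<And>i x. \<bar>coupling u i x\<bar> \<le> C"
proof -
  obtain M where M: "\<And>i x. \<bar>u i x\<bar> \<le> M" using u_bounded by blast
  have "\<bar>coupling u i x\<bar> \<le> B_norm * M" for i x
    using coupling_diff_le[of u x "\<lambda>j x. 0" x M i] M by (simp add: coupling_def)
  then show thesis using that by blast
qed

text \<open>Beyond some radius the superlinearity of \<open>\<alpha>\<close> gives slope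
  \<open>k\<close>; inside it \<open>H\<close> is bounded by continuity and periodicity. Slope 1
  will bound momenta, larger slopes will bound the Lagrangian on balls of velocities.\<close>

lemma H_linear_lower_bound:
  assumes k: "0 \<le> k"
  obtains C where "\<And>i x p. k * norm p - C \<le> H i x p"
proof -
  have "\<forall>\<^sub>F r in at_top. k \<le> \<alpha> r / r"
    using \<alpha>_sl unfolding superlinear_def filterlim_at_top by blast
  then obtain r0 where r0: "\<And>r. r0 \<le> r \<Longrightarrow> k \<le> \<alpha> r / r"
    unfolding eventually_at_top_linorder by blast
  define r1 where "r1 = max r0 1"
  obtain C where C: "\<And>i x p. norm p \<le> r1 \<Longrightarrow> \<bar>H i x p\<bar> \<le> C" using H_bounded by blast
  have "k * norm p - (k * r1 + \<bar>C\<bar>) \<le> H i x p" for i x p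
  proof (cases "norm p \<le> r1")
    case True
    then have "k * norm p \<le> k * r1" using k by (intro mult_left_mono) auto
    then show ?thesis using C[OF True, of i x] by (simp add: abs_le_iff)
  next
    case False
    then have "k \<le> \<alpha> (norm p) / norm p" "0 < norm p" by (auto simp: r1_def intro!: r0)
    then have "k * norm p \<le> H i x p"
      using H_lower[of p i x] by (simp add: pos_le_divide_eq)
    moreover have "0 \<le> k * r1" using k by (simp add: r1_def)
    ultimately show ?thesis by linarith
  qed
  then show thesis using that by blast
qed

lemma lagrangian_upper_bound:
  obtains C where "\<And>i x v p. norm v \<le> R \<Longrightarrow> p \<bullet> v - H i x p \<le> C"
proof -
  obtain C where C: "\<And>i x p. \<bar>R\<bar> * norm p - C \<le> H i x p"
    using H_linear_lower_bound[of "\<bar>R\<bar>"] by auto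
  have "p \<bullet> v - H i x p \<le> C" if "norm v \<le> R" for i x v p
  proof -
    have "p \<bullet> v \<le> norm p * norm v" by (rule norm_cauchy_schwarz)
    also have "\<dots> \<le> norm p * \<bar>R\<bar>" using that by (intro mult_left_mono) auto
    finally show ?thesis using C[of p i x] by (simp add: mult.commute)
  qed
  then show thesis using that by blast
qed

text \<open>A real-valued supremum carries information only over a range bounded above; this makes
  \<open>lagrangian\<close> the genuine Legendre transform and Fenchel's inequality
  available.\<close>

lemma lagrangian_bdd_above: "bdd_above (range (\<lambda>p. p \<bullet> v - H i x p))"
proof -
  obtain C where "\<And>i x w p. norm w \<le> norm v \<Longrightarrow> p \<bullet> w - H i x p \<le> C"
    using lagrangian_upper_bound by blast
  then show ?thesis by (intro bdd_aboveI2[of _ _ C]) auto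
qed

lemma fenchel: "p \<bullet> v - H i x p \<le> L i x v"
  unfolding lagrangian_def by (rule cSUP_upper[OF UNIV_I lagrangian_bdd_above])

lemma lagrangian_le: "(\<And>p. p \<bullet> v - H i x p \<le> C) \<Longrightarrow> L i x v \<le> C"
  unfolding lagrangian_def by (rule cSUP_least) auto

text \<open>The bound concerns momenta admissible in the subsolution inequality, not derivatives of
  \<open>u\<close>, which are not known to exist. It therefore applies to every parabola touching
  \<open>u\<close> from above.\<close>

definition gradient_bound :: "real \<Rightarrow> bool" where
  "gradient_bound K \<longleftrightarrow> (\<forall>i y q. coupling u i y + H i y q \<le> c \<longrightarrow> norm q \<le> K)"

lemma gradient_bound_exists: "\<exists>K. gradient_bound K"
proof -
  obtain C where C: "\<And>i x. \<bar>coupling u i x\<bar> \<le> C" using coupling_u_bounded by blast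
  obtain C' where C': "\<And>i x p. 1 * norm p - C' \<le> H i x p"
    using H_linear_lower_bound[of 1] by auto
  have "norm q \<le> c + C + C'" if "coupling u i y + H i y q \<le> c" for i y q
    using that C[of i y] C'[of q i y] by (simp add: abs_le_iff)
  then show ?thesis unfolding gradient_bound_def by blast
qed

lemma subsolution_touching_parabola:
  assumes "\<And>y'. u i y' - a/2 * (norm (z - y'))\<^sup>2 \<le> u i y - a/2 * (norm (z - y))\<^sup>2"
  shows "coupling u i y + H i y (a *\<^sub>R (y - z)) \<le> c"
proof -
  have "visc_subsol H B c u" using crit by (simp add: visc_sol_def)
  then show ?thesis
    unfolding visc_subsol_def coupling_def using C1_grad_parabola[of a z] assms by (meson zero_less_one)
qed

section \<open>C1 almost-subsolutions and the lower bound\<close>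

text \<open>Along each direction \<open>v\<close> the gradient of the regularization is dominated,
  up to an arbitrarily small error, by the slope \<open>q\<close> of a parabola touching
  \<open>u\<close> from above at a nearby point. The subsolution inequality there is moved to
  \<open>x\<close> by uniform continuity of \<open>H\<close> on momenta of norm at most
  \<open>K\<close>. Since \<open>q\<close> depends on \<open>v\<close>, the conclusion is phrased
  through Fenchel's inequality with \<open>L\<close>, the form that can be integrated.\<close>

lemma C1_subsolution_approximation:
  assumes K: "gradient_bound K" and e: "0 < e"
  obtains f Df where "\<And>i. periodic_fun (f i)" "\<And>i. C1_grad (f i) (Df i)"
    "\<And>i x. \<bar>f i x - u i x\<bar> \<le> e" "\<And>i x. norm (Df i x) \<le> K"
    "\<And>i x v. Df i x \<bullet> v + coupling f i x \<le> L i x v + c + e"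
proof -
  \<comment> \<open>The final error is e1 + 2 * B_norm * e1: one e1 from moving \<open>H\<close>,
    and one coupling error each from moving the point and from replacing \<open>u\<close> by
    \<open>f\<close>.\<close>
  define e1 where "e1 = e / (4 * (1 + B_norm))"
  have e1: "0 < e1" "e1 \<le> e / 4" "B_norm * e1 \<le> e / 4"
    using e B_norm_nonneg by (auto simp: e1_def field_simps)
  obtain M where M: "\<And>i x. \<bar>u i x\<bar> \<le> M" using u_bounded by blast
  have M0: "0 \<le> M" using M[of undefined undefined] by linarith
  obtain d1 where d1: "0 < d1" "\<And>i x y. norm (x - y) < d1 \<Longrightarrow> \<bar>u i x - u i y\<bar> < e1"
    using u_uniformly_continuous[OF e1(1)] by blast
  obtain d2 where d2: "0 < d2"
    "\<And>i x y p. norm p \<le> K \<Longrightarrow> norm (x - y) < d2 \<Longrightarrow> \<bar>H i x p - H i y p\<bar> < e1"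
    using H_uniformly_continuous[OF e1(1)] by blast
  define d where "d = min d1 d2"
  have d: "0 < d" "d \<le> d1" "d \<le> d2" using d1(1) d2(1) by (auto simp: d_def)
  \<comment> \<open>Steep enough that each convolution moves points by at most d/4. Two of them and
    the shift along \<open>v\<close>, also at most d/4, stay below d; M + 1 keeps \<open>a\<close>
    positive.\<close>
  define a where "a = 4 * (M + 1) / (d/4)\<^sup>2"
  have a: "0 < a" using M0 d by (simp add: a_def)
  have small: "sqrt (4 * M / a) \<le> d / 4"
  proof (rule real_le_lsqrt)
    show "4 * M / a \<le> (d / 4)\<^sup>2"
      using M0 d by (simp add: a_def divide_le_eq mult_left_mono)
  qed (use M0 a d in auto)
  have "\<exists>r. (\<forall>x x'. \<bar>lasry_lions a (u i) x' - lasry_lions a (u i) x - r x \<bullet> (x' - x)\<bar> \<le> a * (norm (x' - x))\<^sup>2) \<and>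
      (\<forall>x v t. 0 < t \<longrightarrow> (\<exists>y z. (\<forall>y'. u i y' - a/2 * (norm (z - y'))\<^sup>2 \<le> u i y - a/2 * (norm (z - y))\<^sup>2) \<and>
        norm (y - x) \<le> 2 * sqrt (4 * M / a) + t * norm v \<and>
        r x \<bullet> v \<le> a *\<^sub>R (y - z) \<bullet> v + 3/2 * a * t * (norm v)\<^sup>2)) \<and>
      (\<forall>x. \<exists>y. norm (y - x) \<le> sqrt (4 * M / a) \<and> u i y \<le> lasry_lions a (u i) x) \<and>
      (\<forall>x. \<exists>y. norm (y - x) \<le> sqrt (4 * M / a) \<and> lasry_lions a (u i) x \<le> u i y)" for i
    by (rule lasry_lions_gradient[OF a u_cont[of i] M]) blast
  then obtain r where
    approx: "\<And>i x x'. \<bar>lasry_lions a (u i) x' - lasry_lions a (u i) x - r i x \<bullet> (x' - x)\<bar> \<le> a * (norm (x' - x))\<^sup>2"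
    and slope: "\<And>i x v t. 0 < t \<Longrightarrow> \<exists>y z. (\<forall>y'. u i y' - a/2 * (norm (z - y'))\<^sup>2 \<le> u i y - a/2 * (norm (z - y))\<^sup>2) \<and>
        norm (y - x) \<le> 2 * sqrt (4 * M / a) + t * norm v \<and>
        r i x \<bullet> v \<le> a *\<^sub>R (y - z) \<bullet> v + 3/2 * a * t * (norm v)\<^sup>2"
    and below: "\<And>i x. \<exists>y. norm (y - x) \<le> sqrt (4 * M / a) \<and> u i y \<le> lasry_lions a (u i) x"
    and above: "\<And>i x. \<exists>y. norm (y - x) \<le> sqrt (4 * M / a) \<and> lasry_lions a (u i) x \<le> u i y"
    by metis
  define f where "f i = lasry_lions a (u i)" for i
  have "periodic_fun (f i)" for i
    using u_per[of i] unfolding periodic_fun_def f_def by (auto intro: lasry_lions_periodic)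
  moreover have "C1_grad (f i) (r i)" for i
    unfolding C1_grad_def
  proof (intro conjI allI)
    have "(6 * a)-lipschitz_on UNIV (r i)"
      using quadratically_approximated_imp_Lipschitz_gradient[OF approx[of i]] a
      by (intro lipschitz_onI) (auto simp: dist_norm)
    then show "continuous_on UNIV (r i)" by (rule lipschitz_on_continuous_on)
    show "(f i has_derivative (\<lambda>h. r i x \<bullet> h)) (at x)" for x
      unfolding f_def by (rule quadratically_approximated_imp_has_derivative) (rule approx)
  qed
  moreover have close: "\<bar>f i x - u i x\<bar> \<le> e1" for i x
  proof -
    obtain y z where "norm (y - x) \<le> d / 4" "u i y \<le> f i x" "norm (z - x) \<le> d / 4" "f i x \<le> u i z"
      using below[of x i] above[of x i] small unfolding f_def by (meson order_trans)
    moreover from this have "\<bar>u i y - u i x\<bar> < e1" "\<bar>u i z - u i x\<bar> < e1"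
      using d by (intro d1(2); simp)+
    ultimately show ?thesis by (simp add: abs_le_iff abs_less_iff)
  qed
  moreover have slope': "\<exists>\<tau>>0. \<forall>s. 0 < s \<and> s < 1 \<longrightarrow> (\<exists>q. norm q \<le> K \<and> coupling u i x + H i x q \<le> c + e1 + B_norm * e1 \<and>
      r i x \<bullet> v \<le> q \<bullet> v + s * (3/2 * a * \<tau> * (norm v)\<^sup>2))" for i x v
  proof -
    define k where "k = norm v + 1"
    define \<tau> where "\<tau> = d / (4 * k)"
    have k: "0 < k" by (auto simp: k_def intro: add_nonneg_pos)
    then have \<tau>: "0 < \<tau>" using d by (simp add: \<tau>_def)
    then have "\<tau> * norm v \<le> \<tau> * k" by (intro mult_left_mono) (auto simp: k_def)
    also have "\<dots> = d / 4" using k by (simp add: \<tau>_def)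
    finally have \<tau>_v: "\<tau> * norm v \<le> d / 4" .
    have "\<exists>q. norm q \<le> K \<and> coupling u i x + H i x q \<le> c + e1 + B_norm * e1 \<and>
      r i x \<bullet> v \<le> q \<bullet> v + s * (3/2 * a * \<tau> * (norm v)\<^sup>2)" if s: "0 < s" "s < 1" for s
    proof -
      from slope[OF mult_pos_pos[OF s(1) \<tau>], of i x v] obtain y z where
        "\<forall>y'. u i y' - a/2 * (norm (z - y'))\<^sup>2 \<le> u i y - a/2 * (norm (z - y))\<^sup>2"
        and yz: "norm (y - x) \<le> 2 * sqrt (4 * M / a) + s * \<tau> * norm v"
        "r i x \<bullet> v \<le> a *\<^sub>R (y - z) \<bullet> v + 3/2 * a * (s * \<tau>) * (norm v)\<^sup>2"
        by (elim exE conjE) (rule that; assumption)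
      then have touch: "u i y' - a/2 * (norm (z - y'))\<^sup>2 \<le> u i y - a/2 * (norm (z - y))\<^sup>2" for y'
        by blast
      let ?q = "a *\<^sub>R (y - z)"
      have sub: "coupling u i y + H i y ?q \<le> c" using touch by (rule subsolution_touching_parabola)
      have q: "norm ?q \<le> K" using sub K unfolding gradient_bound_def by blast
      have "s * (\<tau> * norm v) \<le> 1 * (\<tau> * norm v)"
        using s \<tau> by (intro mult_right_mono) auto
      then have near: "norm (y - x) < d" using yz(1) \<tau>_v small d by (simp add: mult.assoc)
      have "\<bar>H i y ?q - H i x ?q\<bar> < e1" using near d by (intro d2(2)[OF q]) simp
      moreover have "\<bar>coupling u i y - coupling u i x\<bar> \<le> B_norm * e1"
        using near d by (intro coupling_diff_le less_imp_le[OF d1(2)]) simp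
      ultimately have "coupling u i x + H i x ?q \<le> c + e1 + B_norm * e1"
        using sub by (simp add: abs_le_iff abs_less_iff)
      then show ?thesis using q yz(2) by (intro exI[of _ ?q]) (simp add: mult_ac)
    qed
    then show ?thesis using \<tau> by blast
  qed
  \<comment> \<open>Choosing the gradient itself as the direction turns the directional estimate
    into a bound of its norm.\<close>
  moreover have "norm (r i x) \<le> K" for i x
  proof -
    obtain \<tau> where \<tau>: "\<And>s. 0 < s \<Longrightarrow> s < 1 \<Longrightarrow> \<exists>q. norm q \<le> K \<and>
        r i x \<bullet> r i x \<le> q \<bullet> r i x + s * (3/2 * a * \<tau> * (norm (r i x))\<^sup>2)"
      using slope'[of i x "r i x"] by metis
    have "(norm (r i x))\<^sup>2 - K * norm (r i x) \<le> 0"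
    proof (rule nonpos_if_le_small_multiples)
      fix s :: real assume "0 < s" "s < 1"
      then obtain q where q: "norm q \<le> K" "r i x \<bullet> r i x \<le> q \<bullet> r i x + s * (3/2 * a * \<tau> * (norm (r i x))\<^sup>2)"
        using \<tau> by blast
      have "q \<bullet> r i x \<le> K * norm (r i x)"
        by (rule order_trans[OF norm_cauchy_schwarz]) (intro mult_right_mono q norm_ge_zero)
      then show "(norm (r i x))\<^sup>2 - K * norm (r i x) \<le> s * (3/2 * a * \<tau> * (norm (r i x))\<^sup>2)"
        using q(2) by (simp add: power2_norm_eq_inner)
    qed
    then have "norm (r i x) * norm (r i x) \<le> norm (r i x) * K" by (simp add: power2_eq_square mult.commute)
    moreover have "0 \<le> K"
    proof -
      obtain q :: "real^'n" where "norm q \<le> K" using \<tau>[of "1/2"] by auto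
      then show ?thesis using norm_ge_zero[of q] by linarith
    qed
    ultimately show ?thesis by (cases "r i x = 0") auto
  qed
  moreover have "r i x \<bullet> v + coupling f i x \<le> L i x v + c + e" for i x v
  proof -
    obtain \<tau> where \<tau>: "\<And>s. 0 < s \<Longrightarrow> s < 1 \<Longrightarrow> \<exists>q. coupling u i x + H i x q \<le> c + e1 + B_norm * e1 \<and>
        r i x \<bullet> v \<le> q \<bullet> v + s * (3/2 * a * \<tau> * (norm v)\<^sup>2)"
      using slope'[of i x v] by metis
    have "r i x \<bullet> v + coupling u i x - (L i x v + c + e1 + B_norm * e1) \<le> 0"
    proof (rule nonpos_if_le_small_multiples)
      fix s :: real assume "0 < s" "s < 1"
      then obtain q where q: "coupling u i x + H i x q \<le> c + e1 + B_norm * e1"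
        "r i x \<bullet> v \<le> q \<bullet> v + s * (3/2 * a * \<tau> * (norm v)\<^sup>2)"
        using \<tau> by blast
      then show "r i x \<bullet> v + coupling u i x - (L i x v + c + e1 + B_norm * e1) \<le> s * (3/2 * a * \<tau> * (norm v)\<^sup>2)"
        using fenchel[of q v i x] by linarith
    qed
    moreover have "\<bar>coupling f i x - coupling u i x\<bar> \<le> B_norm * e1"
      by (rule coupling_diff_le) (rule close)
    ultimately show ?thesis using e1 e by (simp add: abs_le_iff)
  qed
  moreover have "\<bar>f i x - u i x\<bar> \<le> e" for i x
    using close[of i x] e1 e by linarith
  ultimately show thesis using that[of f r] by blast
qed

text \<open>The regularizations have gradients bounded by \<^term>\<open>K\<close> and converge uniformly to \<^term>\<open>u\<close>.\<close>
lemma u_Lipschitz: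
  assumes K: "gradient_bound K"
  shows "\<bar>u i x - u i y\<bar> \<le> K * norm (x - y)"
proof (rule field_le_epsilon)
  fix e :: real assume "0 < e"
  then have "0 < e / 2" by simp
  then obtain f Df where f: "\<And>i. C1_grad (f i) (Df i)"
    "\<And>i x. \<bar>f i x - u i x\<bar> \<le> e / 2" "\<And>i x. norm (Df i x) \<le> K"
    using C1_subsolution_approximation[OF K] by metis
  have "norm (f i x - f i y) \<le> K * norm (x - y)"
  proof (rule differentiable_bound[OF convex_UNIV])
    show "(f i has_derivative (\<lambda>h. Df i z \<bullet> h)) (at z within UNIV)" for z
      using f(1)[of i] by (simp add: C1_grad_def)
    show "onorm (\<lambda>h. Df i z \<bullet> h) \<le> K" for z
    proof (rule onorm_le)
      show "norm (Df i z \<bullet> h) \<le> K * norm h" for h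
        using Cauchy_Schwarz_ineq2[of "Df i z" h] mult_right_mono[OF f(3)[of i z] norm_ge_zero[of h]] by simp
    qed
  qed auto
  then show "\<bar>u i x - u i y\<bar> \<le> K * norm (x - y) + e"
    using f(2)[of i x] f(2)[of i y] unfolding real_norm_def by linarith
qed

text \<open>Periodicity makes \<open>phi\<close> and its gradient bounded, so the integrand grows at
  most linearly in the velocity and the first-moment condition suffices. Integrability is what
  allows the vanishing integral in \<open>closed_measure\<close> to be compared with the
  action.\<close>

lemma integrable_generator:
  assumes sets: "sets \<mu> = sets ((borel :: ((real^'n) \<times> (real^'n)) measure) \<Otimes>\<^sub>M count_space (UNIV :: 'm set))"
    and fin: "finite_measure \<mu>"
    and v: "integrable \<mu> (\<lambda>z. norm (snd (fst z)))"
    and phi: "\<And>i. periodic_fun (phi i)" "\<And>i. C1_grad (phi i) (Dphi i)"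
  shows "integrable \<mu> (\<lambda>z. Dphi (snd z) (fst (fst z)) \<bullet> snd (fst z) + coupling phi (snd z) (fst (fst z)))"
proof -
  have cont: "continuous_on UNIV (phi i)" "continuous_on UNIV (Dphi i)" for i
    using phi(2)[of i] unfolding C1_grad_def
    by (auto intro: has_derivative_continuous continuous_at_imp_continuous_on)
  have "\<exists>C. \<forall>x. norm (Dphi i x) \<le> C \<and> \<bar>phi i x\<bar> \<le> C" for i
  proof -
    have cont': "continuous_on UNIV (\<lambda>(x, p::real). norm (Dphi i x))" "continuous_on UNIV (\<lambda>(x, p::real). phi i x)"
      unfolding split_beta by (intro continuous_intros continuous_on_compose2[OF cont(1)] continuous_on_compose2[OF cont(2)]; simp)+
    have "periodic_fun (\<lambda>x. norm (Dphi i x))"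
      using periodic_fun_gradient[OF phi] by (simp add: periodic_fun_def)
    then obtain C1 where "\<And>x. norm (Dphi i x) \<le> C1"
      using periodic_bounded[of "\<lambda>x p::real. norm (Dphi i x)" "{0}"] cont' by auto
    moreover obtain C2 where "\<And>x. \<bar>phi i x\<bar> \<le> C2"
      using periodic_bounded[of "\<lambda>x p::real. phi i x" "{0}"] phi(1)[of i] cont' by auto
    ultimately have "\<forall>x. norm (Dphi i x) \<le> max C1 C2 \<and> \<bar>phi i x\<bar> \<le> max C1 C2"
      by (meson le_max_iff_disj)
    then show ?thesis ..
  qed
  then obtain C' where C': "\<And>i x. norm (Dphi i x) \<le> C' i" "\<And>i x. \<bar>phi i x\<bar> \<le> C' i" by metis
  define C where "C = Max (range C')"
  have C'_le: "C' i \<le> C" for i by (simp add: C_def)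
  have C: "norm (Dphi i x) \<le> C" "\<bar>phi i x\<bar> \<le> C" for i x
    using C' C'_le order_trans by blast+
  have meas: "(\<lambda>z. Dphi (snd z) (fst (fst z)) \<bullet> snd (fst z) + coupling phi (snd z) (fst (fst z))) \<in> borel_measurable \<mu>"
  proof -
    have "(\<lambda>z. Dphi i (fst (fst z)) \<bullet> snd (fst z) + coupling phi i (fst (fst z))) \<in>
        borel_measurable (borel \<Otimes>\<^sub>M count_space (UNIV :: 'm set))" for i
    proof -
      have "continuous_on UNIV (\<lambda>w::(real^'n) \<times> (real^'n). Dphi i (fst w) \<bullet> snd w + coupling phi i (fst w))"
        unfolding coupling_def by (intro continuous_intros continuous_on_compose2[OF cont(1)] continuous_on_compose2[OF cont(2)]) auto
      then show ?thesis
        by (intro measurable_compose[OF measurable_fst borel_measurable_continuous_onI])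
    qed
    then show ?thesis
      unfolding measurable_cong_sets[OF sets refl]
      by (rule measurable_compose_countable[where g = snd
            and f = "\<lambda>i z. Dphi i (fst (fst z)) \<bullet> snd (fst z) + coupling phi i (fst (fst z))"]) simp
  qed
  interpret finite_measure \<mu> by fact
  have "integrable \<mu> (\<lambda>z. C * norm (snd (fst z)) + B_norm * C)"
    using v by simp
  then show ?thesis
  proof (rule Bochner_Integration.integrable_bound[OF _ meas])
    show "AE z in \<mu>. norm (Dphi (snd z) (fst (fst z)) \<bullet> snd (fst z) + coupling phi (snd z) (fst (fst z)))
        \<le> norm (C * norm (snd (fst z)) + B_norm * C)"
    proof (intro always_eventually allI)
      fix z :: "((real^'n) \<times> (real^'n)) \<times> 'm"
      have "\<bar>Dphi (snd z) (fst (fst z)) \<bullet> snd (fst z)\<bar> \<le> C * norm (snd (fst z))"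
        by (rule order_trans[OF Cauchy_Schwarz_ineq2]) (intro mult_right_mono C norm_ge_zero)
      moreover have "\<bar>coupling phi (snd z) (fst (fst z))\<bar> \<le> B_norm * C"
        using coupling_diff_le[of phi "fst (fst z)" "\<lambda>j x. 0" "fst (fst z)" C "snd z"] C(2) by (simp add: coupling_def)
      ultimately show "norm (Dphi (snd z) (fst (fst z)) \<bullet> snd (fst z) + coupling phi (snd z) (fst (fst z)))
        \<le> norm (C * norm (snd (fst z)) + B_norm * C)"
        by (simp only: real_norm_def)
    qed
  qed
qed

lemma action_of_closed_measure_ge:
  assumes closed: "closed_measure B \<mu>"
    and int: "integrable \<mu> (\<lambda>z. L (snd z) (fst (fst z)) (snd (fst z)))"
  shows "- c \<le> (\<integral>z. L (snd z) (fst (fst z)) (snd (fst z)) \<partial>\<mu>)"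
proof (rule field_le_epsilon)
  fix e :: real assume e: "0 < e"
  interpret prob_space \<mu> using closed by (simp add: closed_measure_def)
  obtain K where K: "gradient_bound K" using gradient_bound_exists by blast
  obtain f Df where f: "\<And>i. periodic_fun (f i)" "\<And>i. C1_grad (f i) (Df i)"
    and le: "\<And>i x v. Df i x \<bullet> v + coupling f i x \<le> L i x v + c + e"
    using C1_subsolution_approximation[OF K e] by metis
  have int_f: "integrable \<mu> (\<lambda>z. Df (snd z) (fst (fst z)) \<bullet> snd (fst z) + coupling f (snd z) (fst (fst z)))"
    using closed f finite_measure_axioms unfolding closed_measure_def by (intro integrable_generator) auto
  have "0 = (\<integral>z. Df (snd z) (fst (fst z)) \<bullet> snd (fst z) + coupling f (snd z) (fst (fst z)) \<partial>\<mu>)"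
    using closed f unfolding closed_measure_def coupling_def by (simp add: add.commute)
  also have "\<dots> \<le> (\<integral>z. L (snd z) (fst (fst z)) (snd (fst z)) + (c + e) \<partial>\<mu>)"
    by (intro integral_mono int_f Bochner_Integration.integrable_add int integrable_const) (use le in \<open>auto simp: add.assoc\<close>)
  also have "\<dots> = (\<integral>z. L (snd z) (fst (fst z)) (snd (fst z)) \<partial>\<mu>) + (c + e)"
    using int by (simp add: prob_space)
  finally show "- c \<le> (\<integral>z. L (snd z) (fst (fst z)) (snd (fst z)) \<partial>\<mu>) + e" by simp
qed

end

section \<open>Existence of a minimizing measure\<close>

text \<open>The graph point over \<open>p\<close> is separated from the strict epigraph, a convex
  set that does not contain it.\<close>

lemma convex_on_has_subgradient:
  fixes f :: "'a::euclidean_space \<Rightarrow> real"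
  assumes f: "convex_on UNIV f"
  obtains v where "\<And>q. f p + v \<bullet> (q - p) \<le> f q"
proof -
  let ?E = "{(q, t). f q < t}"
  have "convex ?E"
    unfolding convex_alt
  proof (intro ballI allI impI)
    fix w w' :: "'a \<times> real" and s :: real
    assume w: "w \<in> ?E" "w' \<in> ?E" and s: "0 \<le> s \<and> s \<le> 1"
    obtain q t q' t' where qt: "w = (q, t)" "w' = (q', t')" by fastforce
    have *: "f q < t" "f q' < t'" "0 \<le> s" "s \<le> 1" using w s by (auto simp: qt)
    have "f ((1 - s) *\<^sub>R q + s *\<^sub>R q') \<le> (1 - s) * f q + s * f q'"
      using f * by (intro convex_onD) auto
    also have "\<dots> < (1 - s) * t + s * t'"
    proof (cases "s = 0")
      case False
      then have "s * f q' < s * t'" using * by simp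
      moreover have "(1 - s) * f q \<le> (1 - s) * t" using * by (intro mult_left_mono) auto
      ultimately show ?thesis by linarith
    qed (use * in simp)
    finally show "(1 - s) *\<^sub>R w + s *\<^sub>R w' \<in> ?E" by (simp add: qt)
  qed
  moreover have "(p, f p + 1) \<in> ?E" by simp
  ultimately have "\<exists>A b. A \<noteq> 0 \<and> (\<forall>w\<in>{(p, f p)}. A \<bullet> w \<le> b) \<and> (\<forall>w\<in>?E. b \<le> A \<bullet> w)"
    by (intro separating_hyperplane_sets convex_singleton) (auto intro: gt_ex)
  then obtain A b where A: "A \<noteq> 0" "\<forall>w\<in>{(p, f p)}. A \<bullet> w \<le> b" "\<forall>w\<in>?E. b \<le> A \<bullet> w"
    by (elim exE conjE) (rule that)
  obtain a s where as: "A = (a, s)" by fastforce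
  have sep: "a \<bullet> p + s * f p \<le> a \<bullet> q + s * t" if "f q < t" for q t
    using A(2) bspec[OF A(3), of "(q, t)"] that by (simp add: as)
  have "0 \<le> s" using sep[of p "f p + 1"] by (simp add: algebra_simps)
  \<comment> \<open>The separating hyperplane is not vertical because the epigraph lies over the
    whole space: testing above p - a would force a = 0.\<close>
  moreover have "s \<noteq> 0"
  proof
    assume s: "s = 0"
    have "a \<bullet> a \<le> 0" using sep[of "p - a" "f (p - a) + 1"] by (simp add: s inner_diff_right)
    then have "a = 0" using inner_ge_zero[of a] inner_eq_zero_iff[of a] by linarith
    then show False using A(1) s as by (simp add: zero_prod_def)
  qed
  ultimately have s: "0 < s" by simp
  have "f p + (- (1/s) *\<^sub>R a) \<bullet> (q - p) \<le> f q" for q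
  proof (rule field_le_epsilon)
    fix e :: real assume "0 < e"
    then have "a \<bullet> p + s * f p \<le> a \<bullet> q + s * (f q + e)" by (intro sep) simp
    then have "(a \<bullet> p + s * f p) / s \<le> (a \<bullet> q + s * (f q + e)) / s" using s by (intro divide_right_mono) auto
    then show "f p + (- (1/s) *\<^sub>R a) \<bullet> (q - p) \<le> f q + e"
      using s by (simp add: add_divide_distrib inner_diff_right diff_divide_distrib)
  qed
  then show thesis using that by blast
qed

text \<open>Along the direction \<open>Dphi x\<close> the difference quotient tends to the squared
  norm of the gradient, so a one-sided growth bound suffices.\<close>

lemma norm_gradient_le:
  fixes phi :: "real^'n \<Rightarrow> real"
  assumes phi: "C1_grad phi Dphi" and K: "0 \<le> K" and le: "\<And>y. phi y - phi x \<le> K * norm (y - x)"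
  shows "norm (Dphi x) \<le> K"
proof -
  let ?D = "Dphi x"
  have "((\<lambda>t. phi (x + t *\<^sub>R ?D)) has_derivative (\<lambda>t. ?D \<bullet> (t *\<^sub>R ?D))) (at 0)"
    by (rule has_derivative_compose[where f = "\<lambda>t. x + t *\<^sub>R ?D" and g = phi])
       (use phi in \<open>auto simp: C1_grad_def intro!: derivative_eq_intros\<close>)
  then have "((\<lambda>t. phi (x + t *\<^sub>R ?D)) has_field_derivative (norm ?D)\<^sup>2) (at 0)"
    by (simp add: has_field_derivative_def power2_norm_eq_inner mult_commute_abs)
  then have "((\<lambda>t. (phi (x + t *\<^sub>R ?D) - phi x) / t) \<longlongrightarrow> (norm ?D)\<^sup>2) (at_right 0)"
    by (auto simp: has_field_derivative_iff intro: tendsto_within_subset)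
  moreover have "(phi (x + t *\<^sub>R ?D) - phi x) / t \<le> K * norm ?D" if "0 < t" for t
    using le[of "x + t *\<^sub>R ?D"] that by (simp add: pos_divide_le_eq mult.assoc mult.left_commute mult.commute[of t])
  ultimately have "(norm ?D)\<^sup>2 \<le> K * norm ?D"
    by (intro tendsto_upperbound) (auto simp: eventually_at_right_field intro!: exI[of _ 1])
  then show ?thesis using K by (cases "?D = 0") (auto simp: power2_eq_square)
qed

section \<open>Pointwise answers to test functions\<close>

context coupled_system
begin

text \<open>The minimum is taken over position and index together. There each u j - phi j is at
  least the one with index \<open>i\<close>, so nonpositive off-diagonal entries and zero row sums
  allow \<open>phi\<close> to replace \<open>u\<close> in the coupling term, leaving an inequality
  about the test function alone.\<close>

lemma supersolution_touching_from_below: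
  assumes phi: "\<And>i. periodic_fun (phi i)" "\<And>i. C1_grad (phi i) (Dphi i)"
  obtains i x where "x \<in> cbox 0 1" "\<And>y. u i x - phi i x \<le> u i y - phi i y"
    "c \<le> coupling phi i x + H i x (Dphi i x)"
proof -
  have w_per: "periodic_fun (\<lambda>x. u j x - phi j x)" for j
    using u_per[of j] phi(1)[of j] by (simp add: periodic_fun_def)
  have w_cont: "continuous_on (cbox 0 1) (\<lambda>x. u j x - phi j x)" for j
    using phi(2)[of j] unfolding C1_grad_def
    by (intro continuous_intros continuous_on_subset[OF u_cont])
       (auto intro: has_derivative_continuous continuous_at_imp_continuous_on)
  have "\<exists>x\<in>cbox 0 1. \<forall>y\<in>cbox 0 1. u j x - phi j x \<le> u j y - phi j y" for j
    using w_cont frac_vec_cbox by (intro continuous_attains_inf) auto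
  then obtain m where m: "\<And>j. m j \<in> cbox 0 1"
    "\<And>j y. y \<in> cbox 0 1 \<Longrightarrow> u j (m j) - phi j (m j) \<le> u j y - phi j y" by metis
  define i where "i = (ARG_MIN (\<lambda>j. u j (m j) - phi j (m j)) j. j \<in> UNIV)"
  have i: "u i (m i) - phi i (m i) \<le> u j (m j) - phi j (m j)" for j
    unfolding i_def using arg_min_least[of UNIV j "\<lambda>j. u j (m j) - phi j (m j)"]
    by (simp add: arg_min_on_def)
  have min: "u i (m i) - phi i (m i) \<le> u j y - phi j y" for j y
    using i[of j] m(2)[OF frac_vec_cbox[of y], of j] periodic_fun_frac_vec[OF w_per[of j], of y] by simp
  have "visc_supersol H B c u" using crit by (simp add: visc_sol_def)
  then have "c \<le> coupling u i (m i) + H i (m i) (Dphi i (m i))"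
    unfolding visc_supersol_def coupling_def using phi(2)[of i] min[of i] zero_less_one by blast
  moreover have "coupling u i (m i) \<le> coupling phi i (m i)"
  proof -
    let ?w = "\<lambda>j. u j (m i) - phi j (m i)"
    have "coupling u i (m i) - coupling phi i (m i) = (\<Sum>j\<in>UNIV. B i j * (?w j - ?w i)) + (\<Sum>j\<in>UNIV. B i j) * ?w i"
      by (simp add: coupling_def sum_subtractf sum_distrib_right algebra_simps sum.distrib)
    also have "(\<Sum>j\<in>UNIV. B i j) = 0" using B by (simp add: coupling_matrix_def)
    also have "(\<Sum>j\<in>UNIV. B i j * (?w j - ?w i)) \<le> 0"
    proof (rule sum_nonpos)
      show "B i j * (?w j - ?w i) \<le> 0" for j
        using B min[of j "m i"] by (cases "j = i") (auto simp: coupling_matrix_def intro!: mult_nonpos_nonneg)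
    qed
    finally show ?thesis by simp
  qed
  ultimately show thesis using that[OF m(1)[of i], of i] min by auto
qed

text \<open>Testing the subgradient inequality one unit away from \<open>p\<close> in the direction
  of \<open>v\<close> bounds |v| by the oscillation of \<open>H\<close> over momenta of norm at most
  K + 1.\<close>

lemma subgradients_bounded:
  obtains R where "\<And>i x p v. norm p \<le> K \<Longrightarrow> (\<And>q. H i x p + v \<bullet> (q - p) \<le> H i x q) \<Longrightarrow> norm v \<le> R"
proof -
  obtain C where C: "\<And>i x p. norm p \<le> K + 1 \<Longrightarrow> \<bar>H i x p\<bar> \<le> C" using H_bounded by blast
  have "norm v \<le> max 0 (2 * C)" if p: "norm p \<le> K" and v: "\<And>q. H i x p + v \<bullet> (q - p) \<le> H i x q" for i x p v
  proof (cases "v = 0")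
    case False
    let ?q = "p + (1 / norm v) *\<^sub>R v"
    have "norm ?q \<le> K + 1"
      using norm_triangle_ineq[of p "(1 / norm v) *\<^sub>R v"] False p by simp
    then have "\<bar>H i x ?q\<bar> \<le> C" "\<bar>H i x p\<bar> \<le> C" using p by (auto intro: C)
    moreover have "v \<bullet> (?q - p) = norm v" using False by (simp add: dot_square_norm power2_eq_square)
    ultimately show ?thesis using v[of ?q] by (auto simp: abs_le_iff)
  qed simp
  then show thesis using that by blast
qed

text \<open>The bound \<open>R\<close> does not depend on the test function: this compactness is what allows passing
  to the limit in measures concentrated on the points \<open>(x, v, i)\<close>.\<close>
lemma bounded_velocity_answers_test_function:
  obtains R where "\<And>phi Dphi. (\<And>i. periodic_fun (phi i)) \<Longrightarrow> (\<And>i. C1_grad (phi i) (Dphi i)) \<Longrightarrow>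
    \<exists>i. \<exists>x\<in>cbox 0 1. \<exists>v\<in>cball 0 R. L i x v + c \<le> Dphi i x \<bullet> v + coupling phi i x"
proof -
  obtain K where K: "gradient_bound K" using gradient_bound_exists by blast
  have K0: "0 \<le> K"
    using u_Lipschitz[OF K, of undefined "axis undefined 1" 0] by simp
  obtain R where R: "\<And>i x p v. norm p \<le> K \<Longrightarrow> (\<And>q. H i x p + v \<bullet> (q - p) \<le> H i x q) \<Longrightarrow> norm v \<le> R"
    using subgradients_bounded by blast
  show thesis
  proof (rule that[of R])
    fix phi :: "'m \<Rightarrow> real^'n \<Rightarrow> real" and Dphi assume phi: "\<And>i. periodic_fun (phi i)" "\<And>i. C1_grad (phi i) (Dphi i)"
    obtain i x where x: "x \<in> cbox 0 1" "\<And>y. u i x - phi i x \<le> u i y - phi i y"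
      "c \<le> coupling phi i x + H i x (Dphi i x)"
      by (rule supersolution_touching_from_below[of phi Dphi, OF phi]) (blast intro: that)
    let ?p = "Dphi i x"
    \<comment> \<open>Touching from below, \<open>phi i\<close> can grow away from \<open>x\<close>
      no faster than \<open>u i\<close> does.\<close>
    have "phi i y - phi i x \<le> K * norm (y - x)" for y
      using x(2)[of y] u_Lipschitz[OF K, of i y x] by (simp add: abs_le_iff)
    then have p: "norm ?p \<le> K" by (rule norm_gradient_le[OF phi(2) K0])
    obtain v where v: "\<And>q. H i x ?p + v \<bullet> (q - ?p) \<le> H i x q"
      using convex_on_has_subgradient[OF H_conv[of i x], of ?p] by blast
    have "norm v \<le> R" using p v by (rule R)
    \<comment> \<open>A subgradient is a velocity for which Fenchel's inequality is attained at the
      momentum \<open>?p\<close>.\<close>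
    moreover have "L i x v \<le> ?p \<bullet> v - H i x ?p"
    proof (rule lagrangian_le)
      show "q \<bullet> v - H i x q \<le> ?p \<bullet> v - H i x ?p" for q
        using v[of q] by (simp add: inner_diff_right inner_commute)
    qed
    ultimately show "\<exists>i. \<exists>x\<in>cbox 0 1. \<exists>v\<in>cball 0 R. L i x v + c \<le> Dphi i x \<bullet> v + coupling phi i x"
      using x by (intro exI[of _ i] bexI[of _ x] bexI[of _ v]) auto
  qed
qed

end

lemma C1_grad_linear_combination:
  fixes phi :: "nat \<Rightarrow> real^'n \<Rightarrow> real"
  assumes "\<And>k. C1_grad (phi k) (Dphi k)"
  shows "C1_grad (\<lambda>x. \<Sum>k<n. a k * phi k x) (\<lambda>x. \<Sum>k<n. a k *\<^sub>R Dphi k x)"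
  unfolding C1_grad_def
proof (intro conjI allI)
  show "continuous_on UNIV (\<lambda>x. \<Sum>k<n. a k *\<^sub>R Dphi k x)"
    using assms unfolding C1_grad_def by (intro continuous_intros) auto
  fix x
  have "((\<lambda>x. \<Sum>k<n. a k * phi k x) has_derivative (\<lambda>h. \<Sum>k<n. a k * (Dphi k x \<bullet> h))) (at x)"
    using assms unfolding C1_grad_def by (intro has_derivative_sum has_derivative_mult_right) auto
  then show "((\<lambda>x. \<Sum>k<n. a k * phi k x) has_derivative (\<lambda>h. (\<Sum>k<n. a k *\<^sub>R Dphi k x) \<bullet> h)) (at x)"
    by (simp add: inner_sum_left)
qed

section \<open>Weak limits of measures on the torus\<close>

lemma borel_measurable_frac_vec: "frac_vec \<in> borel_measurable borel"
proof (rule borel_measurable_euclidean_space[THEN iffD2], rule ballI)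
  fix b :: "real^'n" assume "b \<in> Basis"
  then obtain k where b: "b = axis k 1" by (auto simp: Basis_vec_def)
  have "(\<lambda>x :: real^'n. x $ k - real_of_int \<lfloor>x $ k\<rfloor>) \<in> borel_measurable borel"
  proof -
    have [measurable]: "(\<lambda>x :: real^'n. x $ k) \<in> borel_measurable borel"
      by (intro borel_measurable_continuous_onI continuous_intros)
    show ?thesis by measurable
  qed
  then show "(\<lambda>x. frac_vec x \<bullet> b) \<in> borel_measurable borel"
    by (simp add: b inner_axis frac_vec_def frac_def)
qed

lemma fund_domain_borel: "fund_domain \<in> sets (borel :: (real^'n) measure)"
proof -
  have [measurable]: "(\<lambda>x :: real^'n. x $ k) \<in> borel_measurable borel" for k
    by (intro borel_measurable_continuous_onI continuous_intros)
  have "Measurable.pred borel (\<lambda>x :: real^'n. \<forall>k. 0 \<le> x $ k \<and> x $ k < 1)"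
    by measurable
  then show ?thesis by (simp add: fund_domain_def pred_def)
qed

lemma measurable_pair_count_space:
  fixes f :: "'i::countable \<Rightarrow> 'a \<Rightarrow> 'b"
  assumes "\<And>i. f i \<in> measurable M N"
  shows "(\<lambda>z. f (snd z) (fst z)) \<in> measurable (M \<Otimes>\<^sub>M count_space UNIV) N"
  by (rule measurable_compose_countable[where f = "\<lambda>i z. f i (fst z)" and g = snd])
     (auto intro: measurable_compose[OF measurable_fst assms])

text \<open>The index \<^term>\<open>i\<close> is encoded as the integer \<^term>\<open>to_nat i\<close> in an additional real coordinate, in
  which functions are extended continuously by interpolation; positions are reduced modulo
  the lattice only after the passage to the limit.\<close>
lemma empirical_measures_weak_limit_torus:
  fixes z :: "nat \<Rightarrow> nat \<Rightarrow> ((real^'n) \<times> (real^'n)) \<times> 'm::finite"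
  assumes K: "compact K" and z: "\<And>n t. fst (z n t) \<in> K"
  obtains r \<nu> where "strict_mono (r :: nat \<Rightarrow> nat)" "prob_space \<nu>" "sets \<nu> = sets (borel \<Otimes>\<^sub>M count_space UNIV)"
    "AE w in \<nu>. fst (fst w) \<in> fund_domain"
    "\<And>f. (\<And>i. continuous_on UNIV (f i)) \<Longrightarrow> (\<And>i v. periodic_fun (\<lambda>x. f i (x, v))) \<Longrightarrow>
      integrable \<nu> (\<lambda>w. f (snd w) (fst w) :: real) \<and>
      (\<lambda>n. (\<Sum>t\<le>r n. f (snd (z (r n) t)) (fst (z (r n) t))) / Suc (r n)) \<longlonglongrightarrow> (\<integral>w. f (snd w) (fst w) \<partial>\<nu>)"
proof -
  define code where "code i = real (to_nat i)" for i :: 'm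
  define S where "S = K \<times> range code"
  have S: "compact S"
    unfolding S_def by (intro compact_Times K finite_imp_compact) simp
  define \<zeta> where "\<zeta> n t = (fst (z n t), code (snd (z n t)))" for n t
  have \<zeta>_S: "\<zeta> n t \<in> S" for n t using z by (simp add: \<zeta>_def S_def)
  obtain r \<mu> where r: "strict_mono r" and \<mu>: "prob_space \<mu>" and sets: "sets \<mu> = sets borel"
    and AE_S: "AE w in \<mu>. w \<in> S"
    and lim: "\<And>f :: _ \<Rightarrow> real. continuous_on UNIV f \<Longrightarrow>
       (\<lambda>n. (\<Sum>t\<le>r n. f (\<zeta> (r n) t)) / Suc (r n)) \<longlonglongrightarrow> (\<integral>x. f x \<partial>\<mu>)"
    using empirical_measures_weak_limit[where z = \<zeta>, OF S \<zeta>_S] by blast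
  interpret prob_space \<mu> by fact
  define \<Phi> where "\<Phi> w = ((frac_vec (fst (fst w)), snd (fst w)), from_nat (nat \<lfloor>snd w\<rfloor>) :: 'm)"
    for w :: "((real^'n) \<times> (real^'n)) \<times> real"
  let ?N = "(borel :: ((real^'n) \<times> (real^'n)) measure) \<Otimes>\<^sub>M count_space (UNIV :: 'm set)"
  have \<Phi>: "\<Phi> \<in> measurable \<mu> ?N"
  proof -
    have 1: "(\<lambda>w. frac_vec (fst (fst w))) \<in> borel_measurable (borel :: (((real^'n) \<times> (real^'n)) \<times> real) measure)"
      by (intro measurable_compose[OF _ borel_measurable_frac_vec] borel_measurable_continuous_onI continuous_intros)
    have 2: "(\<lambda>w. snd (fst w)) \<in> borel_measurable (borel :: (((real^'n) \<times> (real^'n)) \<times> real) measure)"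
      by (intro borel_measurable_continuous_onI continuous_intros)
    have [measurable]: "(\<lambda>w. snd w) \<in> borel_measurable (borel :: (((real^'n) \<times> (real^'n)) \<times> real) measure)"
      by (intro borel_measurable_continuous_onI continuous_intros)
    have 3: "(\<lambda>w. from_nat (nat \<lfloor>snd w\<rfloor>)) \<in> measurable (borel :: (((real^'n) \<times> (real^'n)) \<times> real) measure) (count_space (UNIV :: 'm set))"
      by measurable
    have "\<Phi> \<in> measurable borel ?N"
      unfolding \<Phi>_def by (intro measurable_Pair borel_measurable_Pair 1 2 3)
    then show ?thesis unfolding measurable_cong_sets[OF sets refl] .
  qed
  define \<nu> where "\<nu> = distr \<mu> ?N \<Phi>"
  have "prob_space \<nu>" unfolding \<nu>_def by (rule prob_space_distr[OF \<Phi>])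
  moreover have sets_\<nu>: "sets \<nu> = sets ?N" by (simp add: \<nu>_def)
  moreover have "AE w in \<nu>. fst (fst w) \<in> fund_domain"
  proof -
    have [measurable]: "(\<lambda>w. fst (fst w)) \<in> measurable ?N borel"
      by (intro measurable_compose[OF measurable_fst] borel_measurable_continuous_onI continuous_intros)
    have "{w \<in> space ?N. fst (fst w) \<in> fund_domain} \<in> sets ?N"
      using fund_domain_borel by measurable
    then show ?thesis
      unfolding \<nu>_def by (subst AE_distr_iff[OF \<Phi>]) (simp_all add: \<Phi>_def frac_vec_fund_domain)
  qed
  moreover have "integrable \<nu> (\<lambda>w. f (snd w) (fst w)) \<and>
      (\<lambda>n. (\<Sum>t\<le>r n. f (snd (z (r n) t)) (fst (z (r n) t))) / Suc (r n)) \<longlonglongrightarrow> (\<integral>w. f (snd w) (fst w) \<partial>\<nu>)"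
    if f: "\<And>i. continuous_on UNIV (f i)" and per: "\<And>i v. periodic_fun (\<lambda>x. f i (x, v))"
    for f :: "'m \<Rightarrow> (real^'n) \<times> (real^'n) \<Rightarrow> real"
  proof -
    \<comment> \<open>Codes are distinct integers, so the tent of half-width 1 around one code
      vanishes at all the others.\<close>
    define F where "F w = (\<Sum>i\<in>UNIV. max 0 (1 - \<bar>snd w - code i\<bar>) * f i (fst w))"
      for w :: "((real^'n) \<times> (real^'n)) \<times> real"
    have F_cont: "continuous_on UNIV F"
      unfolding F_def by (intro continuous_intros continuous_on_compose2[OF f]) auto
    have F: "F (x, code i) = f i x" for x i
    proof -
      have "max 0 (1 - \<bar>code i - code j\<bar>) = (if j = i then 1 else 0)" for j
      proof (cases "j = i")
        case False
        then have "to_nat i \<noteq> to_nat j" by simp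
        then have "1 \<le> \<bar>code i - code j\<bar>" unfolding code_def by linarith
        then show ?thesis using False by simp
      qed simp
      then have "F (x, code i) = (\<Sum>j\<in>UNIV. if j = i then f i x else 0)"
        unfolding F_def by (intro sum.cong) auto
      then show ?thesis by simp
    qed
    have F_\<zeta>: "F (\<zeta> n t) = f (snd (z n t)) (fst (z n t))" for n t
      by (simp add: \<zeta>_def F)
    have f_meas: "(\<lambda>w. f (snd w) (fst w)) \<in> borel_measurable ?N"
      by (intro measurable_pair_count_space borel_measurable_continuous_onI f)
    have F_meas: "F \<in> borel_measurable \<mu>"
      unfolding measurable_cong_sets[OF sets refl] by (rule borel_measurable_continuous_onI[OF F_cont])
    \<comment> \<open>The interpolation agrees with the decoded function only on \<open>S\<close>,
      where the last coordinate is a code; this is where the support of the limit enters.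
      Periodicity absorbs the discontinuous reduction of the position.\<close>
    have eq: "AE w in \<mu>. f (snd (\<Phi> w)) (fst (\<Phi> w)) = F w"
      using AE_S
    proof eventually_elim
      case (elim w)
      then obtain x v i where w: "w = ((x, v), code i)" by (cases w) (auto simp: S_def)
      have "f (snd (\<Phi> w)) (fst (\<Phi> w)) = f i (frac_vec x, v)" by (simp add: \<Phi>_def w code_def)
      also have "\<dots> = f i (x, v)" using periodic_fun_frac_vec[OF per[of i v], of x] .
      finally show ?case by (simp add: w F)
    qed
    have f\<Phi>_meas: "(\<lambda>w. f (snd (\<Phi> w)) (fst (\<Phi> w))) \<in> borel_measurable \<mu>"
      using measurable_compose[OF \<Phi> f_meas] .
    have "compact (F ` S)" using S by (intro compact_continuous_image continuous_on_subset[OF F_cont]) auto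
    then have "bounded (F ` S)" by (rule compact_imp_bounded)
    then obtain C where C: "\<And>w. w \<in> S \<Longrightarrow> norm (F w) \<le> C" by (auto simp: bounded_iff)
    have "integrable \<mu> F"
      by (rule integrable_const_bound[of _ C]) (use AE_S C F_meas in auto)
    then have "integrable \<mu> (\<lambda>w. f (snd (\<Phi> w)) (fst (\<Phi> w)))"
      using eq by (subst integrable_cong_AE[OF f\<Phi>_meas F_meas])
    then have "integrable \<nu> (\<lambda>w. f (snd w) (fst w))"
      unfolding \<nu>_def by (subst integrable_distr_eq[OF \<Phi> f_meas])
    moreover have "(\<integral>w. f (snd w) (fst w) \<partial>\<nu>) = (\<integral>w. F w \<partial>\<mu>)"
      unfolding \<nu>_def integral_distr[OF \<Phi> f_meas] by (rule integral_cong_AE[OF f\<Phi>_meas F_meas eq])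
    ultimately show ?thesis using lim[OF F_cont] by (simp only: F_\<zeta>)
  qed
  ultimately show thesis using that[of r \<nu>] r by blast
qed

lemma continuous_on_Max_image:
  fixes h :: "nat \<Rightarrow> 'a::topological_space \<Rightarrow> real"
  assumes "\<And>k. continuous_on S (h k)"
  shows "continuous_on S (\<lambda>w. Max ((\<lambda>k. h k w) ` {..n}))"
proof (induction n)
  case (Suc n)
  have "Max ((\<lambda>k. h k w) ` {..Suc n}) = max (h (Suc n) w) (Max ((\<lambda>k. h k w) ` {..n}))" for w
    by (simp add: atMost_Suc)
  then show ?case using Suc assms by (simp add: continuous_on_max)
qed (use assms in simp)

section \<open>Construction of the minimizer\<close>

context coupled_system
begin

text \<open>The play is run with the cost L + c against a sequence that is uniformly dense among the
  generators of test functions on the compact set of states. Uniform closeness there carries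
  vanishing averages over to every test function.\<close>

lemma near_optimal_points:
  obtains R z where "\<And>n t. fst (z n t) \<in> cbox 0 1 \<times> cball 0 R"
    "\<And>n. (\<Sum>t\<le>n. L (snd (z n t)) (fst (fst (z n t))) (snd (fst (z n t)))) / Suc n \<le> - c + 1 / sqrt (Suc n)"
    "\<And>phi Dphi. (\<And>i. periodic_fun (phi i)) \<Longrightarrow> (\<And>i. C1_grad (phi i) (Dphi i)) \<Longrightarrow>
      (\<lambda>n. (\<Sum>t\<le>n. Dphi (snd (z n t)) (fst (fst (z n t))) \<bullet> snd (fst (z n t)) +
        coupling phi (snd (z n t)) (fst (fst (z n t)))) / Suc n) \<longlonglongrightarrow> 0"
proof -
  obtain R where R: "\<And>phi Dphi. (\<And>i. periodic_fun (phi i)) \<Longrightarrow> (\<And>i. C1_grad (phi i) (Dphi i)) \<Longrightarrow>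
    \<exists>i. \<exists>x\<in>cbox 0 1. \<exists>v\<in>cball 0 R. L i x v + c \<le> Dphi i x \<bullet> v + coupling phi i x"
    using bounded_velocity_answers_test_function by blast
  define K where "K = (cbox 0 1 \<times> cball 0 R :: ((real^'n) \<times> (real^'n)) set)"
  define test where "test phi Dphi \<longleftrightarrow> (\<forall>i. periodic_fun (phi i) \<and> C1_grad (phi i) (Dphi i))"
    for phi :: "'m \<Rightarrow> real^'n \<Rightarrow> real" and Dphi
  \<comment> \<open>All indices are collected in one vector, so that a single uniform approximation
    is valid for every index at once.\<close>
  define gen where "gen phi Dphi w = (\<chi> i. Dphi i (fst w) \<bullet> snd w + coupling phi i (fst w))"
    for phi :: "'m \<Rightarrow> real^'n \<Rightarrow> real" and Dphi and w :: "(real^'n) \<times> (real^'n)"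
  define F where "F = {gen phi Dphi | phi Dphi. test phi Dphi}"
  have K: "compact K" unfolding K_def by (intro compact_Times) auto
  have test_0: "test (\<lambda>i x. 0) (\<lambda>i x. 0)"
    by (simp add: test_def periodic_fun_def C1_grad_def)
  have cont: "continuous_on UNIV (phi i)" "continuous_on UNIV (Dphi i)" if "test phi Dphi" for phi Dphi i
    using that unfolding test_def C1_grad_def
    by (auto intro: has_derivative_continuous continuous_at_imp_continuous_on)
  have F_cont: "continuous_on K f" if "f \<in> F" for f
  proof -
    obtain phi Dphi where f: "f = gen phi Dphi" "test phi Dphi" using \<open>f \<in> F\<close> by (auto simp: F_def)
    show ?thesis
      unfolding f(1) gen_def coupling_def
      by (intro continuous_intros continuous_on_compose2[OF cont(1)[OF f(2)]] continuous_on_compose2[OF cont(2)[OF f(2)]]) auto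
  qed
  have "F \<noteq> {}" using test_0 by (auto simp: F_def)
  obtain D :: "nat \<Rightarrow> (real^'n) \<times> (real^'n) \<Rightarrow> real^'m" where D: "\<And>n. D n \<in> F"
    and D_dense: "\<And>f e. f \<in> F \<Longrightarrow> 0 < e \<Longrightarrow> \<exists>n. \<forall>w\<in>K. dist (f w) (D n w) < e"
    using uniformly_dense_sequence_exists[OF K \<open>F \<noteq> {}\<close> F_cont] by blast
  have "\<exists>phi Dphi. D n = gen phi Dphi \<and> test phi Dphi" for n
    using D[of n] by (auto simp: F_def)
  then obtain psi Dpsi where psi: "\<And>n. D n = gen (psi n) (Dpsi n)" "\<And>n. test (psi n) (Dpsi n)"
    by metis
  define X where "X = {w :: ((real^'n) \<times> (real^'n)) \<times> 'm. fst w \<in> K}"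
  define f where "f w = L (snd w) (fst (fst w)) (snd (fst w)) + c" for w
  define g where "g k w = D k (fst w) $ snd w" for k and w :: "((real^'n) \<times> (real^'n)) \<times> 'm"
  obtain C0 where C0: "\<And>i x p. norm p \<le> 0 \<Longrightarrow> \<bar>H i x p\<bar> \<le> C0" using H_bounded by blast
  \<comment> \<open>Momentum 0 in Fenchel's inequality bounds the Lagrangian from below by - H i x
    0.\<close>
  have f_ge: "- (C0 - c) \<le> f w" for w
    using fenchel[of 0 "snd (fst w)" "snd w" "fst (fst w)"] C0[of 0 "snd w" "fst (fst w)"]
    by (simp add: f_def abs_le_iff)
  have "\<exists>m. \<forall>w\<in>K. norm (D k w) \<le> m" for k
    using compact_imp_bounded[OF compact_continuous_image[OF F_cont[OF D[of k]] K]]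
    by (auto simp: bounded_iff)
  then obtain m where m: "\<And>k w. w \<in> K \<Longrightarrow> norm (D k w) \<le> m k" by metis
  have g_le: "\<bar>g k w\<bar> \<le> m k" if "w \<in> X" for k w
    using component_le_norm_cart[of "D k (fst w)" "snd w"] m[of "fst w" k] that by (simp add: g_def X_def)
  \<comment> \<open>The generator is linear in the test function, so a combination of the
    \<open>D k\<close> is again the generator of one test function and has a pointwise
    answer.\<close>
  have answer: "\<exists>w\<in>X. f w \<le> (\<Sum>k<n. a k * g k w)" for a n
  proof -
    define phi where "phi i x = (\<Sum>k<n. a k * psi k i x)" for i x
    define Dphi where "Dphi i x = (\<Sum>k<n. a k *\<^sub>R Dpsi k i x)" for i x
    have "periodic_fun (phi i)" for i
      using psi(2) by (simp add: test_def periodic_fun_def phi_def)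
    moreover have "C1_grad (phi i) (Dphi i)" for i
      unfolding phi_def Dphi_def using psi(2) by (intro C1_grad_linear_combination) (simp add: test_def)
    ultimately obtain i x v where ixv: "x \<in> cbox 0 1" "v \<in> cball 0 R"
      "L i x v + c \<le> Dphi i x \<bullet> v + coupling phi i x"
      using R[of phi Dphi] by blast
    have "coupling phi i x = (\<Sum>k<n. a k * coupling (psi k) i x)"
      unfolding coupling_def phi_def sum_distrib_left by (subst sum.swap) (simp add: mult_ac)
    then have "Dphi i x \<bullet> v + coupling phi i x = (\<Sum>k<n. a k * g k ((x, v), i))"
      by (simp add: g_def psi(1) gen_def Dphi_def inner_sum_left sum.distrib algebra_simps)
    then show ?thesis
      using ixv by (intro bexI[of _ "((x, v), i)"]) (auto simp: f_def X_def K_def)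
  qed
  obtain z where z: "\<And>n t. z n t \<in> X"
    "\<And>n. (\<Sum>t\<le>n. f (z n t)) / Suc n \<le> 1 / sqrt (Suc n)"
    "\<And>k. (\<lambda>n. (\<Sum>t\<le>n. g k (z n t)) / Suc n) \<longlonglongrightarrow> 0"
    using averages_of_answered_combinations[of X "C0 - c" f g m] f_ge g_le answer by blast
  show thesis
  proof (rule that[of z R])
    show "fst (z n t) \<in> cbox 0 1 \<times> cball 0 R" for n t
      using z(1)[of n t] by (simp add: X_def K_def)
    show "(\<Sum>t\<le>n. L (snd (z n t)) (fst (fst (z n t))) (snd (fst (z n t)))) / Suc n \<le> - c + 1 / sqrt (Suc n)" for n
    proof -
      have "(\<Sum>t\<le>n. f (z n t)) / Suc n = (\<Sum>t\<le>n. L (snd (z n t)) (fst (fst (z n t))) (snd (fst (z n t)))) / Suc n + c"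
        by (simp add: f_def sum.distrib add_divide_distrib del: of_nat_Suc)
      then show ?thesis using z(2)[of n] by linarith
    qed
    fix phi :: "'m \<Rightarrow> real^'n \<Rightarrow> real" and Dphi assume "\<And>i. periodic_fun (phi i)" "\<And>i. C1_grad (phi i) (Dphi i)"
    then have test: "test phi Dphi" by (simp add: test_def)
    let ?g = "\<lambda>w. gen phi Dphi (fst w) $ snd w"
    have "(\<lambda>n. (\<Sum>t\<le>n. ?g (z n t)) / Suc n) \<longlonglongrightarrow> 0"
    proof (rule LIMSEQ_I)
      fix e :: real assume e: "0 < e"
      obtain k where k: "\<And>w. w \<in> K \<Longrightarrow> dist (gen phi Dphi w) (D k w) < e / 2"
        using D_dense[of "gen phi Dphi" "e / 2"] test e by (auto simp: F_def)
      obtain N where N: "\<And>n. N \<le> n \<Longrightarrow> \<bar>(\<Sum>t\<le>n. g k (z n t)) / Suc n\<bar> < e / 2"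
        using LIMSEQ_D[OF z(3)[of k], of "e / 2"] e by auto
      have "\<bar>(\<Sum>t\<le>n. ?g (z n t)) / Suc n\<bar> < e" if n: "N \<le> n" for n
      proof -
        have le: "\<bar>?g (z n t) - g k (z n t)\<bar> \<le> e / 2" for t
        proof -
          have "\<bar>?g (z n t) - g k (z n t)\<bar> \<le> norm (gen phi Dphi (fst (z n t)) - D k (fst (z n t)))"
            using component_le_norm_cart[of "gen phi Dphi (fst (z n t)) - D k (fst (z n t))" "snd (z n t)"]
            by (simp add: g_def)
          also have "\<dots> < e / 2"
            using k[of "fst (z n t)"] z(1)[of n t] by (simp add: X_def dist_norm)
          finally show ?thesis by simp
        qed
        have "\<bar>(\<Sum>t\<le>n. ?g (z n t)) - (\<Sum>t\<le>n. g k (z n t))\<bar> \<le> (\<Sum>t\<le>n. e / 2)"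
          unfolding sum_subtractf[symmetric] by (rule order_trans[OF sum_abs]) (intro sum_mono le)
        then have "\<bar>(\<Sum>t\<le>n. ?g (z n t)) / Suc n - (\<Sum>t\<le>n. g k (z n t)) / Suc n\<bar> \<le> e / 2"
          unfolding diff_divide_distrib[symmetric] abs_divide
          by (simp add: divide_le_eq mult.commute)
        then show ?thesis using N[OF n] by linarith
      qed
      then show "\<exists>N. \<forall>n\<ge>N. norm ((\<Sum>t\<le>n. ?g (z n t)) / Suc n - 0) < e"
        by (intro exI[of _ N]) simp
    qed
    then show "(\<lambda>n. (\<Sum>t\<le>n. Dphi (snd (z n t)) (fst (fst (z n t))) \<bullet> snd (fst (z n t)) +
        coupling phi (snd (z n t)) (fst (fst (z n t)))) / Suc n) \<longlonglongrightarrow> 0"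
      by (simp add: gen_def)
  qed
qed

lemma H_continuous_in_momentum: "continuous_on UNIV (H i x)"
proof -
  have "continuous_on UNIV (\<lambda>p. (x, p))" by (intro continuous_intros)
  from continuous_on_compose2[OF H_cont[of i] this] show ?thesis by simp
qed

text \<open>The Lagrangian is only known to be lower semicontinuous, so it is exhausted from below by
  continuous functions: finite maxima of \<^term>\<open>p \<bullet> v - H i x p\<close> over a dense set of momenta.\<close>
lemma lagrangian_limit_of_maxima:
  obtains p :: "nat \<Rightarrow> real^'n" where
    "\<And>i x v. (\<lambda>n. Max ((\<lambda>k. p k \<bullet> v - H i x (p k)) ` {..n})) \<longlonglongrightarrow> L i x v"
proof -
  obtain Q :: "(real^'n) set" where Q: "countable Q" "\<And>X. open X \<Longrightarrow> X \<noteq> {} \<Longrightarrow> \<exists>q\<in>Q. q \<in> X"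
    by (metis countable_dense_exists)
  have "Q \<noteq> {}" using Q(2)[of UNIV] by auto
  define p where "p = from_nat_into Q"
  have "(\<lambda>n. Max ((\<lambda>k. p k \<bullet> v - H i x (p k)) ` {..n})) \<longlonglongrightarrow> L i x v" for i x v
  proof (rule LIMSEQ_I)
    fix e :: real assume e: "0 < e"
    let ?h = "\<lambda>q. q \<bullet> v - H i x q"
    have "L i x v - e < L i x v" using e by simp
    then obtain q where "L i x v - e < ?h q"
      unfolding lagrangian_def using less_cSUP_iff[OF _ lagrangian_bdd_above] by blast
    then have "{q. L i x v - e < ?h q} \<noteq> {}" by blast
    moreover have "open {q. L i x v - e < ?h q}"
      by (intro open_Collect_less continuous_intros H_continuous_in_momentum)
    ultimately obtain q' where q': "q' \<in> Q" "L i x v - e < ?h q'" using Q(2) by blast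
    obtain k where k: "p k = q'" using from_nat_into_surj[OF Q(1) q'(1)] by (auto simp: p_def)
    have "norm (Max ((\<lambda>k. ?h (p k)) ` {..n}) - L i x v) < e" if "k \<le> n" for n
    proof -
      have "?h (p k) \<le> Max ((\<lambda>k. ?h (p k)) ` {..n})" using that by (intro Max_ge) auto
      moreover have "Max ((\<lambda>k. ?h (p k)) ` {..n}) \<le> L i x v" by (subst Max_le_iff) (auto intro: fenchel)
      ultimately show ?thesis using q'(2) e by (simp add: k)
    qed
    then show "\<exists>N. \<forall>n\<ge>N. norm (Max ((\<lambda>k. ?h (p k)) ` {..n}) - L i x v) < e" by blast
  qed
  then show thesis using that by blast
qed

text \<open>Closedness passes to the weak limit because the integrands are continuous and periodic.
  The action is handled through the increasing minorants \<open>h n\<close>: for fixed n the weak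
  limit gives an integral at most - c, and monotone convergence in n then yields both integrability
  of the Lagrangian and action at most - c.\<close>

lemma minimizing_measure_exists:
  "\<exists>\<mu>. closed_measure B \<mu> \<and> integrable \<mu> (\<lambda>z. L (snd z) (fst (fst z)) (snd (fst z))) \<and>
     (\<integral>z. L (snd z) (fst (fst z)) (snd (fst z)) \<partial>\<mu>) = - c"
proof (rule near_optimal_points)
  let ?L = "\<lambda>z. L (snd z) (fst (fst z)) (snd (fst z))"
  fix R and z :: "nat \<Rightarrow> nat \<Rightarrow> ((real^'n) \<times> (real^'n)) \<times> 'm"
  assume z: "\<And>n t. fst (z n t) \<in> cbox 0 1 \<times> cball 0 R"
    and z_L: "\<And>n. (\<Sum>t\<le>n. ?L (z n t)) / Suc n \<le> - c + 1 / sqrt (Suc n)"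
    and z_gen: "\<And>phi Dphi. (\<And>i. periodic_fun (phi i)) \<Longrightarrow> (\<And>i. C1_grad (phi i) (Dphi i)) \<Longrightarrow>
      (\<lambda>n. (\<Sum>t\<le>n. Dphi (snd (z n t)) (fst (fst (z n t))) \<bullet> snd (fst (z n t)) +
        coupling phi (snd (z n t)) (fst (fst (z n t)))) / Suc n) \<longlonglongrightarrow> 0"
  have K: "compact (cbox 0 1 \<times> cball 0 R :: ((real^'n) \<times> (real^'n)) set)" by (intro compact_Times) auto
  obtain r \<nu> where r: "strict_mono r" and prob: "prob_space \<nu>"
    and sets: "sets \<nu> = sets (borel \<Otimes>\<^sub>M count_space UNIV)"
    and fund: "AE w in \<nu>. fst (fst w) \<in> fund_domain"
    and lim: "\<And>f. (\<And>i. continuous_on UNIV (f i)) \<Longrightarrow> (\<And>i v. periodic_fun (\<lambda>x. f i (x, v))) \<Longrightarrow>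
      integrable \<nu> (\<lambda>w. f (snd w) (fst w) :: real) \<and>
      (\<lambda>n. (\<Sum>t\<le>r n. f (snd (z (r n) t)) (fst (z (r n) t))) / Suc (r n)) \<longlonglongrightarrow> (\<integral>w. f (snd w) (fst w) \<partial>\<nu>)"
    using empirical_measures_weak_limit_torus[where z = z, OF K z] by blast
  have r_lim: "filterlim r sequentially sequentially" using r by (rule filterlim_subseq)
  have closed: "closed_measure B \<nu>"
    unfolding closed_measure_def
  proof (intro conjI prob sets fund allI impI)
    have "continuous_on UNIV (\<lambda>w::(real^'n) \<times> (real^'n). norm (snd w))" by (intro continuous_intros)
    then show "integrable \<nu> (\<lambda>w. norm (snd (fst w)))"
      using lim[of "\<lambda>i w. norm (snd w)"] by (simp add: periodic_fun_def)
  next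
    fix phi :: "'m \<Rightarrow> real^'n \<Rightarrow> real" and Dphi assume "\<forall>i. periodic_fun (phi i) \<and> C1_grad (phi i) (Dphi i)"
    then have phi: "\<And>i. periodic_fun (phi i)" "\<And>i. C1_grad (phi i) (Dphi i)" by auto
    have cont: "continuous_on UNIV (phi i)" "continuous_on UNIV (Dphi i)" for i
      using phi(2)[of i] unfolding C1_grad_def
      by (auto intro: has_derivative_continuous continuous_at_imp_continuous_on)
    define f where "f i w = Dphi i (fst w) \<bullet> snd w + coupling phi i (fst w)" for i w
    have "continuous_on UNIV (f i)" for i
      unfolding f_def coupling_def
      by (intro continuous_intros continuous_on_compose2[OF cont(1)] continuous_on_compose2[OF cont(2)]) auto
    moreover have "periodic_fun (\<lambda>x. f i (x, v))" for i v
      using phi(1) periodic_fun_gradient[OF phi, of i] by (simp add: periodic_fun_def f_def coupling_def)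
    ultimately have "(\<lambda>n. (\<Sum>t\<le>r n. f (snd (z (r n) t)) (fst (z (r n) t))) / Suc (r n)) \<longlonglongrightarrow> (\<integral>w. f (snd w) (fst w) \<partial>\<nu>)"
      using lim by blast
    moreover have "(\<lambda>n. (\<Sum>t\<le>r n. f (snd (z (r n) t)) (fst (z (r n) t))) / Suc (r n)) \<longlonglongrightarrow> 0"
      using filterlim_compose[OF z_gen[OF phi] r_lim] by (simp add: f_def)
    ultimately have "(\<integral>w. f (snd w) (fst w) \<partial>\<nu>) = 0" by (rule LIMSEQ_unique)
    then show "(\<integral>w. (\<Sum>j\<in>UNIV. B (snd w) j * phi j (fst (fst w))) + Dphi (snd w) (fst (fst w)) \<bullet> snd (fst w) \<partial>\<nu>) = 0"
      by (simp add: f_def coupling_def add.commute)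
  qed
  obtain p :: "nat \<Rightarrow> real^'n" where
    p: "\<And>i x v. (\<lambda>n. Max ((\<lambda>k. p k \<bullet> v - H i x (p k)) ` {..n})) \<longlonglongrightarrow> L i x v"
    using lagrangian_limit_of_maxima by blast
  define h where "h n i w = Max ((\<lambda>k. p k \<bullet> snd w - H i (fst w) (p k)) ` {..n})" for n i w
  have h_le: "h n i w \<le> L i (fst w) (snd w)" for n i w
    unfolding h_def by (subst Max_le_iff) (auto intro: fenchel)
  have h_cont: "continuous_on UNIV (h n i)" for n i
    unfolding h_def
  proof (intro continuous_on_Max_image continuous_intros)
    show "continuous_on UNIV (\<lambda>w::(real^'n) \<times> (real^'n). H i (fst w) (p k))" for k
    proof -
      have "continuous_on UNIV (\<lambda>w::(real^'n) \<times> (real^'n). (fst w, p k))" by (intro continuous_intros)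
      from continuous_on_compose2[OF H_cont[of i] this] show ?thesis by simp
    qed
  qed
  have h_per: "periodic_fun (\<lambda>x. h n i (x, v))" for n i v
    using H_per by (simp add: periodic_fun_def h_def)
  have h_int: "integrable \<nu> (\<lambda>w. h n (snd w) (fst w))" for n
    using lim[of "h n"] h_cont h_per by blast
  have h_integral: "(\<integral>w. h n (snd w) (fst w) \<partial>\<nu>) \<le> - c" for n
  proof (rule tendsto_le[OF sequentially_bot])
    show "(\<lambda>k. (\<Sum>t\<le>r k. h n (snd (z (r k) t)) (fst (z (r k) t))) / Suc (r k)) \<longlonglongrightarrow> (\<integral>w. h n (snd w) (fst w) \<partial>\<nu>)"
      using lim[of "h n"] h_cont h_per by blast
    have "(\<lambda>n. - c + 1 / sqrt (Suc n)) \<longlonglongrightarrow> - c" by real_asymp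
    then show "(\<lambda>k. - c + 1 / sqrt (Suc (r k))) \<longlonglongrightarrow> - c" by (rule filterlim_compose[OF _ r_lim])
    show "\<forall>\<^sub>F k in sequentially. (\<Sum>t\<le>r k. h n (snd (z (r k) t)) (fst (z (r k) t))) / Suc (r k) \<le> - c + 1 / sqrt (Suc (r k))"
    proof (intro always_eventually allI)
      fix k
      have "(\<Sum>t\<le>r k. h n (snd (z (r k) t)) (fst (z (r k) t))) / Suc (r k) \<le> (\<Sum>t\<le>r k. ?L (z (r k) t)) / Suc (r k)"
        by (intro divide_right_mono sum_mono h_le) simp
      then show "(\<Sum>t\<le>r k. h n (snd (z (r k) t)) (fst (z (r k) t))) / Suc (r k) \<le> - c + 1 / sqrt (Suc (r k))"
        using z_L[of "r k"] by linarith
    qed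
  qed
  have h_mono: "mono (\<lambda>n. h n i w)" for i w
    unfolding h_def by (intro monoI Max_mono) auto
  have "incseq (\<lambda>n. \<integral>w. h n (snd w) (fst w) \<partial>\<nu>)"
    by (intro monoI integral_mono h_int monoD[OF h_mono])
  then obtain l where l: "(\<lambda>n. \<integral>w. h n (snd w) (fst w) \<partial>\<nu>) \<longlonglongrightarrow> l"
    using incseq_convergent[of "\<lambda>n. \<integral>w. h n (snd w) (fst w) \<partial>\<nu>" "- c"] h_integral by blast
  have h_lim: "(\<lambda>n. h n (snd w) (fst w)) \<longlonglongrightarrow> ?L w" for w
    unfolding h_def by (rule p)
  have L_meas: "?L \<in> borel_measurable \<nu>"
    by (rule borel_measurable_LIMSEQ_real[OF h_lim]) (use h_int in blast)
  have L_int: "integrable \<nu> ?L"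
    by (rule integrable_monotone_convergence[OF h_int _ _ l L_meas]) (use h_mono h_lim in auto)
  have "(\<integral>w. ?L w \<partial>\<nu>) = l"
    by (rule integral_monotone_convergence[OF h_int _ _ l L_meas]) (use h_mono h_lim in auto)
  also have "l \<le> - c" using l by (rule LIMSEQ_le_const2) (use h_integral in blast)
  finally have "(\<integral>w. ?L w \<partial>\<nu>) = - c"
    using action_of_closed_measure_ge[OF closed L_int] by linarith
  then show "\<exists>\<mu>. closed_measure B \<mu> \<and> integrable \<mu> ?L \<and> (\<integral>z. ?L z \<partial>\<mu>) = - c"
    using closed L_int by blast
qed

end

theorem theorem3p2:
  fixes H :: "'m::finite \<Rightarrow> real^'n \<Rightarrow> real^'n \<Rightarrow> real"
    and B :: "'m \<Rightarrow> 'm \<Rightarrow> real"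
    and \<alpha> \<beta> :: "real \<Rightarrow> real"
    and c :: real
    and u :: "'m \<Rightarrow> real^'n \<Rightarrow> real"
  assumes H_cont: "\<And>i. continuous_on UNIV (\<lambda>(x, p). H i x p)"
    and H_per: "\<And>i p. periodic_fun (\<lambda>x. H i x p)"
    and H_conv: "\<And>i x. convex_on UNIV (H i x)"
    and H_bounds: "\<And>i x p. \<alpha> (norm p) \<le> H i x p \<and> H i x p \<le> \<beta> (norm p)"
    and \<alpha>_sl: "superlinear \<alpha>" and \<beta>_sl: "superlinear \<beta>"
    and B: "coupling_matrix B"
    and crit: "visc_sol H B c u"
  shows "(\<exists>\<mu>. closed_measure B \<mu> \<and>
        integrable \<mu> (\<lambda>z. lagrangian H (snd z) (fst (fst z)) (snd (fst z))) \<and>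
        (\<integral>z. lagrangian H (snd z) (fst (fst z)) (snd (fst z)) \<partial>\<mu>) = - c) \<and>
    (\<forall>\<mu>. closed_measure B \<mu> \<and>
        integrable \<mu> (\<lambda>z. lagrangian H (snd z) (fst (fst z)) (snd (fst z))) \<longrightarrow>
        - c \<le> (\<integral>z. lagrangian H (snd z) (fst (fst z)) (snd (fst z)) \<partial>\<mu>))"
proof -
  interpret coupled_system H B \<alpha> c u
    using assms by unfold_locales auto
  show ?thesis
    using minimizing_measure_exists action_of_closed_measure_ge by blast
qed

end
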